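(* Let $\mathcal{D}$ be a finite nonempty set of integers with the property that $\prod_{D\in\mathcal{A}}D$ is not a perfect square whenever $\mathcal{A}\subseteq\mathcal{D}$ has odd cardinality. Let $\mathcal{S}=(s_1,s_2,\ldots)$ be the sequence of positive integers, in increasing order, representable by any binary quadratic form of any discriminant $D\in\mathcal{D}$ (that is, the positive integers $n$ for which there exist an integral binary quadratic form $Q$ whose discriminant belongs to $\mathcal{D}$ and integers $x,y$ with $Q(x,y)=n$). Let $d:=\operatorname{lcm}\{\,|D| : D\in\mathcal{D}\,\}$. Then $$\limsup_{n\to\infty}\frac{s_{n+1}-s_n}{\log s_n}\ \geq\ \frac{1}{\log d+\log\log d+\log\log\log d+4}.$$
   Context: An integral binary quadratic form is $Q(x,y)=ax^2+bxy+cy^2$ with $a,b,c\in\mathbb{Z}$; its discriminant is $b^2-4ac$. An integer $n$ is represented by $Q$ if $Q(x,y)=n$ for some integers $x,y$. A perfect square is an integer of the form $m^2$ with $m\in\mathbb{Z}$. $\log$ is the natural logarithm. *)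

theory Defs
  imports "HOL-Analysis.Analysis" "HOL-Computational_Algebra.Nth_Powers"
begin

definition bqf :: "int \<Rightarrow> int \<Rightarrow> int \<Rightarrow> int \<Rightarrow> int \<Rightarrow> int" where
  "bqf a b c x y = a * x^2 + b * x * y + c * y^2"

definition bqf_disc :: "int \<Rightarrow> int \<Rightarrow> int \<Rightarrow> int" where
  "bqf_disc a b c = b^2 - 4 * a * c"

definition represented_set :: "int set \<Rightarrow> nat set" where
  "represented_set \<D> =
     {n. n > 0 \<and> (\<exists>a b c. bqf_disc a b c \<in> \<D> \<and> (\<exists>x y. bqf a b c x y = int n))}"

text \<open>
  A strictly monotone \<open>s :: nat \<Rightarrow> nat\<close> with \<open>range s = A\<close> is the unique increasing
  enumeration of \<open>A\<close>, with \<open>s 0\<close> the least element. For \<open>A = represented_set \<D>\<close> one exists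
  as soon as some element of \<open>\<D>\<close> is a discriminant, i.e. congruent to 0 or 1 modulo 4;
  otherwise \<open>represented_set \<D>\<close> is empty and there is no sequence.
\<close>

lemma represented_set_enumeration_exists:
  assumes "D \<in> \<D>" and "D mod 4 = 0 \<or> D mod 4 = 1"
  shows "\<exists>s :: nat \<Rightarrow> nat. strict_mono s \<and> range s = represented_set \<D>"
proof -
  obtain b c where bc: "bqf_disc 1 b c = D"
  proof (cases "D mod 4 = 0")
    case True
    then have "bqf_disc 1 0 (- (D div 4)) = D"
      using mult_div_mod_eq[of 4 D] by (simp add: bqf_disc_def)
    then show ?thesis by (rule that)
  next
    case False
    then have "D mod 4 = 1" using assms(2) by blast
    then have "bqf_disc 1 1 (- (D div 4)) = D"
      using mult_div_mod_eq[of 4 D] by (simp add: bqf_disc_def)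
    then show ?thesis by (rule that)
  qed
  have "(Suc k)^2 \<in> represented_set \<D>" for k
  proof -
    have "bqf 1 b c (int (Suc k)) 0 = int ((Suc k)^2)"
      by (simp add: bqf_def)
    then show ?thesis
      unfolding represented_set_def using bc assms(1)
      by (intro CollectI conjI exI[of _ 1] exI[of _ b] exI[of _ c]
                exI[of _ "int (Suc k)"] exI[of _ 0]) simp_all
  qed
  then have "range (\<lambda>k. (Suc k)^2) \<subseteq> represented_set \<D>" by blast
  moreover have "infinite (range (\<lambda>k. (Suc k)^2))"
    by (rule range_inj_infinite) (auto intro!: injI simp: power2_eq_iff_nonneg)
  ultimately have inf: "infinite (represented_set \<D>)"
    using finite_subset by blast
  show ?thesis
    using inf by (intro exI[of _ "enumerate (represented_set \<D>)"])
      (simp add: strict_mono_enumerate range_enumerate)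
qed

end

theory Submission
  imports Defs "HOL-Number_Theory.Number_Theory" "HOL-Real_Asymp.Real_Asymp"
begin

text \<open>
  Orthogonality of characters gives a class \<open>a\<close> modulo \<open>d\<close> on which all Kronecker symbols \<open>(D/\<cdot>)\<close> equal
  \<open>-1\<close>, so for each \<open>D\<close> every \<open>d j + a\<close> is divisible to an odd power by a prime \<open>p\<close> with \<open>(D/p) = -1\<close>.
  Following Richards, choose \<open>y\<close> with \<open>d y \<equiv> a\<close> modulo a product of such primes; then \<open>y + j\<close> inherits these odd
  powers and is not represented, for all \<open>1 \<le> j \<le> k\<close>. Only primes up to \<open>\<epsilon> k\<close> enter through high powers.
  The larger ones enter to the first power, \<open>y\<close> being chosen by averaging so that their squares do no harm.
  To bound the modulus, the primes up to \<open>k\<close> cost at most \<open>\<theta>(k) \<le> k ln 4\<close>. The primes above \<open>k\<close> are counted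
  only if they divide some \<open>d j + a\<close>; comparing \<open>\<Prod>\<^sub>j (d j + a)\<close> with \<open>k!\<close> shows that they
  cost at most \<open>k (ln d + \<Sum>\<^sub>p\<^sub>|\<^sub>d ln p / (p - 1)) + O(ln k)\<close>, and a bound of Mertens type for the sum over
  \<open>p | d\<close> finishes the proof. No prime number theorem is needed.
\<close>

section \<open>Quadratic characters\<close>

text \<open>The size of the modulus decides the constant. Imposing each of the roughly
  \<open>d * k / ln k\<close> primes up to \<open>d * k\<close> through a high power would cost
  several \<open>ln k\<close> per prime; a first power costs only \<open>ln p\<close>. The price is
  that \<open>y + j\<close> might be divisible by the square of such a prime, and the freedom in
  \<open>y\<close> is spent on avoiding this. The total cost per unit of \<open>k\<close> is
  \<open>ln d\<close> plus the sum of \<open>ln p / (p - 1)\<close> over \<open>p | d\<close> plus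
  \<open>ln 4\<close>. The sum can grow like \<open>ln (ln d)\<close>, whence that term of the
  claim; \<open>ln (ln (ln d))\<close> is slack that absorbs crude constants once
  \<open>ln d >= 45\<close>, and explicit evaluation covers smaller \<open>d\<close>. The case
  \<open>d = 3\<close> is special: there \<open>ln (ln (ln d))\<close> is about -2.4 and
  \<open>ln 4\<close> is too much, but all inert primes lie in the class 2 modulo 3. Elements that
  are not discriminants carry no forms; they are dropped, and the bound for the smaller lcm passes
  to \<open>d\<close> by monotonicity.\<close>

lemma Legendre_values: "Legendre a p \<in> {-1, 0, 1}"
  by (auto simp: Legendre_def)

lemma Legendre_cong:
  assumes "[a = b] (mod p)"
  shows "Legendre a p = Legendre b p"
proof -
  have "[a = 0] (mod p) \<longleftrightarrow> [b = 0] (mod p)" "QuadRes p a \<longleftrightarrow> QuadRes p b"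
    using assms unfolding QuadRes_def by (meson cong_sym cong_trans)+
  then show ?thesis by (simp add: Legendre_def)
qed

text \<open>Two values in {-1, 0, 1} differ by at most 2, so a modulus above 2 separates them. This
  turns Euler's criterion, a congruence, into equalities.\<close>

lemma sign_cong_imp_eq:
  fixes x y p :: int
  assumes "[x = y] (mod p)" "p > 2" "x \<in> {-1, 0, 1}" "y \<in> {-1, 0, 1}"
  shows "x = y"
proof -
  have "p dvd x - y" using assms(1) by (simp add: cong_iff_dvd_diff)
  moreover have "\<bar>x - y\<bar> < p" using assms(2-4) by auto
  ultimately show ?thesis using dvd_imp_le_int[of "x - y" p] assms(2) by fastforce
qed

lemma Legendre_mult:
  fixes p :: nat
  assumes "prime p" "2 < p"
  shows "Legendre (a * b) p = Legendre a p * Legendre b p"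
proof (rule sign_cong_imp_eq)
  have "[Legendre (a * b) p = (a * b) ^ ((p - 1) div 2)] (mod p)"
    using euler_criterion assms by blast
  moreover have "[Legendre a p * Legendre b p = (a * b) ^ ((p - 1) div 2)] (mod p)"
    unfolding power_mult_distrib using euler_criterion assms by (intro cong_mult) blast+
  ultimately show "[Legendre (a * b) p = Legendre a p * Legendre b p] (mod p)"
    by (meson cong_sym cong_trans)
  show "int p > 2" using assms by simp
  show "Legendre (a * b) p \<in> {-1, 0, 1}" by (rule Legendre_values)
  show "Legendre a p * Legendre b p \<in> {-1, 0, 1}"
    using Legendre_values[of a p] Legendre_values[of b p] by auto
qed

section \<open>The characters modulo 4 and 8, equal to (-1/n) and (2/n) at odd positive n, and the
  supplementary laws\<close>

definition sign4 :: "int \<Rightarrow> int" where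
  "sign4 n = (if even n then 0 else if n mod 4 = 1 then 1 else -1)"

definition sign8 :: "int \<Rightarrow> int" where
  "sign8 n = (if even n then 0 else if n mod 8 = 1 \<or> n mod 8 = 7 then 1 else -1)"

lemma odd_mod_8_int: "odd n \<Longrightarrow> n mod 8 = 1 \<or> n mod 8 = 3 \<or> n mod 8 = 5 \<or> n mod 8 = (7::int)"
  by presburger

lemma sign4_mod: "sign4 (n mod 4) = sign4 n"
  by (simp add: sign4_def dvd_mod_iff)

lemma sign8_mod: "sign8 (n mod 8) = sign8 n"
  by (simp add: sign8_def dvd_mod_iff)

lemma sign4_mult: "sign4 (m * n) = sign4 m * sign4 n"
proof (cases "even m \<or> even n")
  case False
  define a b where "a = m mod 4" and "b = n mod 4"
  have "a = 1 \<or> a = 3" "b = 1 \<or> b = 3"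
    using False unfolding a_def b_def by presburger+
  then have "sign4 (a * b) = sign4 a * sign4 b"
    by (elim disjE) (simp_all add: sign4_def)
  moreover have "sign4 (a * b) = sign4 (m * n)"
    unfolding a_def b_def by (metis mod_mult_eq sign4_mod)
  ultimately show ?thesis by (simp add: a_def b_def sign4_mod)
qed (auto simp: sign4_def)

lemma sign8_mult: "sign8 (m * n) = sign8 m * sign8 n"
proof (cases "even m \<or> even n")
  case False
  define a b where "a = m mod 8" and "b = n mod 8"
  have "a = 1 \<or> a = 3 \<or> a = 5 \<or> a = 7" "b = 1 \<or> b = 3 \<or> b = 5 \<or> b = 7"
    using False odd_mod_8_int unfolding a_def b_def by auto
  then have "sign8 (a * b) = sign8 a * sign8 b"
    by (elim disjE) (simp_all add: sign8_def)
  moreover have "sign8 (a * b) = sign8 (m * n)"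
    unfolding a_def b_def by (metis mod_mult_eq sign8_mod)
  ultimately show ?thesis by (simp add: a_def b_def sign8_mod)
qed (auto simp: sign8_def)

lemma sign4_of_nat:
  assumes "odd p"
  shows "sign4 (int p) = (-1) ^ ((p - 1) div 2)"
proof -
  have m: "int p mod 4 = int (p mod 4)" by (simp add: zmod_int)
  have "p mod 4 = 1 \<or> p mod 4 = 3" using assms by presburger
  then show ?thesis
  proof
    assume 1: "p mod 4 = 1"
    then have "even ((p - 1) div 2)" by presburger
    then show ?thesis using 1 m assms by (simp add: sign4_def)
  next
    assume 3: "p mod 4 = 3"
    then have "odd ((p - 1) div 2)" by presburger
    then show ?thesis using 3 m assms by (simp add: sign4_def)
  qed
qed

lemma Legendre_minus_one:
  fixes p :: nat
  assumes "prime p" "2 < p"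
  shows "Legendre (-1) p = sign4 p"
proof (rule sign_cong_imp_eq)
  have odd: "odd p" using assms prime_odd_nat by blast
  then show "[Legendre (-1) p = sign4 p] (mod p)"
    using euler_criterion[OF assms, of "-1"] sign4_of_nat[OF odd] by simp
qed (use assms Legendre_values in \<open>auto simp: sign4_def\<close>)

text \<open>Gauss's lemma with multiplier 2: with \<open>h = (p - 1) / 2\<close>, the sign is the
  parity of \<open>h - h div 2\<close>, which depends only on \<open>p mod 8\<close>.\<close>

lemma Legendre_two:
  fixes p :: nat
  assumes "prime p" "2 < p"
  shows "Legendre 2 p = sign8 p"
proof -
  have odd: "odd p" using assms prime_odd_nat by blast
  have "\<not> p dvd 2" using assms by (auto dest: dvd_imp_le)
  then have "\<not> int p dvd 2" by (metis int_dvd_int_iff of_nat_numeral)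
  then interpret GAUSS p 2
    using assms by unfold_locales (auto simp: cong_0_iff)
  define h where "h = (int p - 1) div 2"
  have ph: "int p = 2 * h + 1" using odd unfolding h_def by presburger
  \<comment> \<open>The doubles of 1, ..., h stay below \<open>p\<close>, so nothing is reduced, and
    those above \<open>h\<close> are the doubles of the \<open>x\<close> with
    \<open>h div 2 < x \<le> h\<close>.\<close>
  have "C = B"
  proof -
    have "x mod int p = x" if "x \<in> B" for x
      using that ph unfolding B_def A_def h_def by auto
    then show ?thesis unfolding C_def by simp
  qed
  then have "E = (\<lambda>x. x * 2) ` {h div 2 <.. h}"
    unfolding E_def B_def A_def h_def[symmetric] using ph assms by auto
  then have "card E = nat (h - h div 2)"
    by (simp add: card_image inj_on_def)
  then have L: "Legendre 2 p = (-1) ^ nat (h - h div 2)"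
    using gauss_lemma by simp
  have h0: "h \<ge> 0" using ph assms by linarith
  obtain t where t: "int p = 8 * t + 1 \<or> int p = 8 * t + 3 \<or> int p = 8 * t + 5 \<or> int p = 8 * t + 7"
    using odd_mod_8_int[of "int p"] odd mult_div_mod_eq[of 8 "int p"] by (metis even_of_nat)
  have mods: "(8 * t + 1) mod 8 = 1" "(8 * t + 3) mod 8 = 3" "(8 * t + 5) mod 8 = 5" "(8 * t + 7) mod 8 = 7"
    by simp_all
  from t consider "h = 4 * t" "int p mod 8 = 1" | "h = 4 * t + 1" "int p mod 8 = 3"
    | "h = 4 * t + 2" "int p mod 8 = 5" | "h = 4 * t + 3" "int p mod 8 = 7"
    using ph mods by fastforce
  then have "even (h - h div 2) \<longleftrightarrow> int p mod 8 = 1 \<or> int p mod 8 = 7"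
  proof cases
    case 4
    moreover have "(4 * t + 3) div 2 = 2 * t + 1" by presburger
    ultimately show ?thesis by simp
  qed simp_all
  moreover have "even (nat (h - h div 2)) \<longleftrightarrow> even (h - h div 2)"
    using h0 by (simp add: even_nat_iff)
  ultimately show ?thesis using L odd by (simp add: sign8_def)
qed

section \<open>The Jacobi symbol and reciprocity between a prime and an odd number\<close>

definition Jacobi :: "int \<Rightarrow> nat \<Rightarrow> int" where
  "Jacobi n u = (\<Prod>q\<in>#prime_factorization u. Legendre n (int q))"

lemma Jacobi_1 [simp]: "Jacobi n (Suc 0) = 1"
  by (simp add: Jacobi_def)

lemma Jacobi_prime [simp]: "prime q \<Longrightarrow> Jacobi n q = Legendre n (int q)"
  by (simp add: Jacobi_def prime_factorization_prime)

lemma Jacobi_mult_right: "u > 0 \<Longrightarrow> v > 0 \<Longrightarrow> Jacobi n (u * v) = Jacobi n u * Jacobi n v"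
  by (simp add: Jacobi_def prime_factorization_mult)

lemma odd_prime_factor_gt_2:
  fixes q u :: nat
  assumes "odd u" "q \<in> prime_factors u"
  shows "2 < q"
proof -
  have "prime q" "q dvd u" using assms(2) by auto
  moreover have "q \<noteq> 2" using assms(1) \<open>q dvd u\<close> by auto
  ultimately show ?thesis using prime_ge_2_nat[of q] by linarith
qed

lemma Jacobi_mult_left:
  assumes "odd u"
  shows "Jacobi (m * n) u = Jacobi m u * Jacobi n u"
proof -
  have "Jacobi (m * n) u = (\<Prod>q\<in>#prime_factorization u. Legendre m (int q) * Legendre n (int q))"
    unfolding Jacobi_def
    using odd_prime_factor_gt_2[OF assms]
    by (intro arg_cong[of _ _ prod_mset] image_mset_cong Legendre_mult)
      (auto dest: in_prime_factors_imp_prime)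
  also have "\<dots> = Jacobi m u * Jacobi n u"
    by (simp add: Jacobi_def prod_mset.distrib)
  finally show ?thesis .
qed

lemma Jacobi_cong:
  assumes "[m = n] (mod int u)"
  shows "Jacobi m u = Jacobi n u"
  unfolding Jacobi_def
  using assms by (intro arg_cong[of _ _ prod_mset] image_mset_cong Legendre_cong)
    (auto intro: cong_dvd_modulus simp: in_prime_factors_iff)

lemma Jacobi_values:
  assumes "coprime n (int u)"
  shows "Jacobi n u \<in> {-1, 1}"
proof -
  have "Legendre n (int q) \<in> {-1, 1}" if "q \<in># prime_factorization u" for q
  proof -
    have "prime q" "q dvd u" using that by auto
    then have "\<not> int q dvd n"
      using assms by (meson coprime_common_divisor int_dvd_int_iff not_prime_unit prime_nat_int_transfer)
    then show ?thesis by (auto simp: Legendre_def cong_0_iff)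
  qed
  then have "(\<Prod>q\<in>#M. Legendre n (int q)) \<in> {-1, 1}"
    if "set_mset M \<subseteq> prime_factors u" for M
    using that by (induction M) force+
  then show ?thesis unfolding Jacobi_def by blast
qed

lemma odd_nat_prime_induct [consumes 1, case_names 1 mult]:
  fixes u :: nat
  assumes "odd u" "P 1" "\<And>q u. prime q \<Longrightarrow> 2 < q \<Longrightarrow> odd u \<Longrightarrow> P u \<Longrightarrow> P (q * u)"
  shows "P u"
  using assms(1)
proof (induction u rule: prime_divisors_induct)
  case zero
  then show ?case by simp
next
  case (unit x)
  then show ?case using assms(2) by simp
next
  case (factor p x)
  then have "odd p" "odd x" by auto
  then show ?case using factor assms(3)[of p x] prime_ge_2_nat[of p]
    by (metis even_numeral le_neq_implies_less)
qed

lemma Legendre_1 [simp]: "1 < p \<Longrightarrow> Legendre 1 p = 1"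
  unfolding Legendre_def QuadRes_def
  by (auto simp: cong_0_iff intro!: exI[of _ 1])

text \<open>Both sides are multiplicative in \<open>u\<close>, so quadratic reciprocity for one
  prime factor at a time suffices. The correction is multiplicative because residues 1 and 3 modulo
  4 multiply like signs and \<open>sign4 p\<close> squares to 1.\<close>

lemma Legendre_Jacobi_reciprocity:
  fixes p u :: nat
  assumes "prime p" "2 < p" "odd u" "\<not> p dvd u"
  shows "Legendre (int u) p = Jacobi p u * (if u mod 4 = 3 then sign4 p else 1)"
  using assms(3,4)
proof (induction u rule: odd_nat_prime_induct)
  case 1
  then show ?case using assms by simp
next
  case (mult q u)
  have nd: "\<not> p dvd u" "p \<noteq> q" using mult.prems by auto
  have odds: "odd p" "odd q" using assms mult.hyps prime_odd_nat by blast+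
  have "\<not> [int q = 0] (mod p)" "\<not> [int p = 0] (mod q)"
    using nd assms mult.hyps by (simp_all add: cong_0_iff primes_dvd_imp_eq) (use primes_dvd_imp_eq in blast)+
  then have L: "Legendre q p \<in> {-1,1}" "Legendre p q \<in> {-1,1}" by (auto simp: Legendre_def)
  have "Legendre p q * Legendre q p = (-1) ^ ((p - 1) div 2 * ((q - 1) div 2))"
    using Quadratic_Reciprocity assms mult.hyps nd by blast
  also have "\<dots> = (if q mod 4 = 3 then sign4 p else 1)"
  proof (cases "q mod 4 = 3")
    case True
    have "odd ((q - 1) div 2)" using True by presburger
    then show ?thesis using True sign4_of_nat[OF odds(1)] by (simp add: uminus_power_if)
  next
    case False
    then have "even ((q - 1) div 2)" using odds(2) by presburger
    then have "even ((p - 1) div 2 * ((q - 1) div 2))" by (rule dvd_mult)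
    then have "(-1::int) ^ ((p - 1) div 2 * ((q - 1) div 2)) = 1" by (rule neg_one_even_power)
    then show ?thesis using False by (simp only: if_False)
  qed
  finally have *: "Legendre q p = Legendre p q * (if q mod 4 = 3 then sign4 p else 1)"
    using L odds(1) by (auto simp: sign4_def split: if_splits)
  have "Legendre (int (q * u)) p = Legendre q p * Legendre u p"
    using Legendre_mult assms by simp
  also have "\<dots> = Jacobi p (q * u) * ((if q mod 4 = 3 then sign4 p else 1) * (if u mod 4 = 3 then sign4 p else 1))"
    using mult.IH nd mult.hyps by (simp add: * Jacobi_mult_right odd_pos prime_gt_0_nat)
  also have "(if q mod 4 = 3 then sign4 p else 1) * (if u mod 4 = 3 then sign4 p else 1)
      = (if (q * u) mod 4 = 3 then sign4 p else 1)"
  proof -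
    have "(q * u) mod 4 = ((q mod 4) * (u mod 4)) mod 4" by (simp add: mod_simps)
    moreover have "q mod 4 = 1 \<or> q mod 4 = 3" "u mod 4 = 1 \<or> u mod 4 = 3"
      using odds mult.hyps by presburger+
    moreover have "sign4 p * sign4 p = 1" using odds by (simp add: sign4_def)
    ultimately show ?thesis by auto
  qed
  finally show ?case .
qed

lemma Jacobi_2:
  assumes "odd u"
  shows "Jacobi 2 u = sign8 (int u)"
  using assms
proof (induction u rule: odd_nat_prime_induct)
  case 1
  then show ?case by (simp add: sign8_def)
next
  case (mult q u)
  then show ?case
    by (simp add: Jacobi_mult_right odd_pos prime_gt_0_nat Legendre_two sign8_mult)
qed

section \<open>The Kronecker symbol, its periodicity, and inert primes\<close>

definition odd_part :: "int \<Rightarrow> int" where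
  "odd_part D = D div 2 ^ multiplicity 2 D"

lemma odd_part_decompose: "D = 2 ^ multiplicity 2 D * odd_part D"
  unfolding odd_part_def using multiplicity_dvd[of 2 D] by simp

lemma odd_odd_part:
  assumes "D \<noteq> 0"
  shows "odd (odd_part D)"
  using multiplicity_decompose[of D 2] assms by (auto simp: odd_part_def)

lemma odd_part_mult:
  assumes "D \<noteq> 0" "E \<noteq> 0"
  shows "odd_part (D * E) = odd_part D * odd_part E"
proof -
  have "multiplicity 2 (D * E) = multiplicity 2 D + multiplicity 2 E"
    using assms by (simp add: prime_elem_multiplicity_mult_distrib)
  moreover have "D * E = 2 ^ (multiplicity 2 D + multiplicity 2 E) * (odd_part D * odd_part E)"
    using odd_part_decompose[of D] odd_part_decompose[of E] by (simp add: power_add) (metis mult.assoc mult.left_commute)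
  ultimately show ?thesis
    by (metis nonzero_mult_div_cancel_left odd_part_def power_not_zero zero_neq_numeral)
qed

text \<open>The Kronecker symbol \<open>(D/n)\<close>, with reciprocity built in: written through symbols whose upper argument
  is \<open>n\<close>, it is visibly periodic in \<open>n\<close> when \<open>D\<close> is a discriminant, and correct for even \<open>n\<close> as well.\<close>
definition kronecker :: "int \<Rightarrow> int \<Rightarrow> int" where
  "kronecker D n = Jacobi n (nat \<bar>odd_part D\<bar>) * (if odd_part D mod 4 = 3 then sign4 n else 1)
     * (if odd (multiplicity 2 D) then sign8 n else 1)"

text \<open>This is (D/p) = -1. Every integer is a square modulo 2, so at \<open>p = 2\<close> the
  residue condition is replaced by \<open>D mod 8 = 5\<close>. For odd \<open>p\<close>, divisors of
  \<open>D\<close> are excluded because 0 counts as a quadratic residue.\<close>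

definition inert :: "nat \<Rightarrow> int \<Rightarrow> bool" where
  "inert p D \<longleftrightarrow> prime p \<and> (if p = 2 then D mod 8 = 5 else \<not> QuadRes (int p) D)"

lemma inert_prime: "inert p D \<Longrightarrow> prime p"
  by (simp add: inert_def)

lemma inert_not_dvd:
  assumes "inert p D"
  shows "\<not> int p dvd D"
proof
  assume dvd: "int p dvd D"
  show False
  proof (cases "p = 2")
    case True
    then show False using assms dvd unfolding inert_def by simp presburger
  next
    case False
    have "QuadRes (int p) D"
      unfolding QuadRes_def using dvd by (intro exI[of _ 0]) (simp add: cong_iff_dvd_diff)
    then show False using assms False by (simp add: inert_def)
  qed
qed

lemma kronecker_mult_right:
  assumes "D \<noteq> 0"
  shows "kronecker D (m * n) = kronecker D m * kronecker D n"
  using odd_odd_part[OF assms]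
  by (simp add: kronecker_def Jacobi_mult_left even_nat_iff sign4_mult sign8_mult)

lemma sign4_square: "odd n \<Longrightarrow> sign4 n * sign4 n = 1"
  by (simp add: sign4_def)

lemma sign8_square: "odd n \<Longrightarrow> sign8 n * sign8 n = 1"
  by (simp add: sign8_def)

text \<open>The sign factors combine only because they square to 1, which needs \<open>n\<close>
  odd: at even \<open>n\<close> they vanish, and already \<open>D = E = 2\<close> gives 1 on the
  left and 0 on the right.\<close>

lemma kronecker_mult_left:
  assumes "D \<noteq> 0" "E \<noteq> 0" "odd n"
  shows "kronecker (D * E) n = kronecker D n * kronecker E n"
proof -
  let ?s = "\<lambda>w. if w mod 4 = 3 then sign4 n else 1"
  let ?t = "\<lambda>D. if odd (multiplicity 2 D) then sign8 n else 1"
  have odd: "odd (odd_part D)" "odd (odd_part E)"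
    using assms odd_odd_part by blast+
  then have pos: "nat \<bar>odd_part D\<bar> > 0" "nat \<bar>odd_part E\<bar> > 0" by auto
  have "?s (odd_part D * odd_part E) = ?s (odd_part D) * ?s (odd_part E)"
  proof -
    have "(odd_part D * odd_part E) mod 4 = ((odd_part D mod 4) * (odd_part E mod 4)) mod 4"
      by (simp add: mod_simps)
    moreover have "odd_part D mod 4 = 1 \<or> odd_part D mod 4 = 3" "odd_part E mod 4 = 1 \<or> odd_part E mod 4 = 3"
      using odd by presburger+
    ultimately show ?thesis using sign4_square[OF assms(3)] by auto
  qed
  moreover have "?t (D * E) = ?t D * ?t E"
    using assms sign8_square[OF assms(3)] by (simp add: prime_elem_multiplicity_mult_distrib)
  moreover have "Jacobi n (nat \<bar>odd_part D * odd_part E\<bar>)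
      = Jacobi n (nat \<bar>odd_part D\<bar>) * Jacobi n (nat \<bar>odd_part E\<bar>)"
    using pos by (simp add: abs_mult nat_mult_distrib Jacobi_mult_right)
  ultimately show ?thesis
    by (simp only: kronecker_def odd_part_mult[OF assms(1,2)] ac_simps)
qed

lemma kronecker_1 [simp]: "kronecker 1 n = 1"
  by (simp add: kronecker_def odd_part_def)

lemma kronecker_prod:
  assumes "\<And>D. D \<in> A \<Longrightarrow> D \<noteq> 0" "odd n"
  shows "kronecker (\<Prod>D\<in>A. D) n = (\<Prod>D\<in>A. kronecker D n)"
  using assms(1)
proof (induction A rule: infinite_finite_induct)
  case (insert D A)
  then show ?case using assms(2) by (simp add: kronecker_mult_left)
qed simp_all

lemma disc_cases:
  fixes D :: int
  assumes "D mod 4 = 0 \<or> D mod 4 = 1" "D \<noteq> 0"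
  obtains "odd D" "multiplicity 2 D = 0" "odd_part D = D" "D mod 4 = 1"
  | "4 dvd D" "multiplicity 2 D \<ge> 2"
proof (cases "even D")
  case True
  then have "4 dvd D" using assms by presburger
  then have "(2::int) ^ 2 dvd D" by simp
  then have "multiplicity 2 D \<ge> 2" using assms by (intro multiplicity_geI) auto
  then show ?thesis using \<open>4 dvd D\<close> that(2) by blast
next
  case False
  then have "multiplicity 2 D = 0" by (simp add: not_dvd_imp_multiplicity_0)
  moreover have "D mod 4 = 1" using False assms by presburger
  ultimately show ?thesis using False that(1) by (simp add: odd_part_def)
qed

lemma odd_part_dvd: "odd_part D dvd D"
  using odd_part_decompose[of D] by (metis dvd_triv_right)

text \<open>A discriminant is either odd and 1 modulo 4, and then neither sign factor is present, or
  divisible by 4, the period of \<open>sign4\<close>. The factor \<open>sign8\<close> occurs only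
  when the exponent of 2 is odd, hence at least 3, so that 8 divides \<open>D\<close>.\<close>

lemma kronecker_cong:
  assumes "D mod 4 = 0 \<or> D mod 4 = 1" "D \<noteq> 0" "[m = n] (mod D)"
  shows "kronecker D m = kronecker D n"
proof -
  have "[m = n] (mod int (nat \<bar>odd_part D\<bar>))"
    using assms(3) odd_part_dvd[of D] by (auto simp: cong_iff_dvd_diff intro: dvd_trans)
  then have J: "Jacobi m (nat \<bar>odd_part D\<bar>) = Jacobi n (nat \<bar>odd_part D\<bar>)"
    by (rule Jacobi_cong)
  show ?thesis using assms(1,2)
  proof (cases rule: disc_cases)
    case 1
    then show ?thesis using J by (simp add: kronecker_def)
  next
    case 2
    then have "[m = n] (mod 4)"
      using assms(3) by (auto simp: cong_iff_dvd_diff intro: dvd_trans)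
    then have s4: "sign4 m = sign4 n" unfolding unique_euclidean_semiring_class.cong_def by (metis sign4_mod)
    have s8: "sign8 m = sign8 n" if "odd (multiplicity 2 D)"
    proof -
      have "multiplicity 2 D \<ge> 3" using 2 that by (cases "multiplicity 2 D = 2") auto
      then have "(2::int) ^ 3 dvd D" using multiplicity_dvd' by blast
      then have "8 dvd D" by simp
      then have "[m = n] (mod 8)"
        using assms(3) by (auto simp: cong_iff_dvd_diff intro: dvd_trans)
      then show ?thesis unfolding unique_euclidean_semiring_class.cong_def by (metis sign8_mod)
    qed
    show ?thesis using J s4 s8 by (simp add: kronecker_def)
  qed
qed

lemma kronecker_values:
  assumes "D mod 4 = 0 \<or> D mod 4 = 1" "D \<noteq> 0" "coprime n D"
  shows "kronecker D n \<in> {-1, 1}"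
proof -
  have "coprime n (int (nat \<bar>odd_part D\<bar>))"
    using coprime_divisors[OF dvd_refl _ assms(3), of "int (nat \<bar>odd_part D\<bar>)"] odd_part_dvd[of D]
    by simp
  then have J: "Jacobi n (nat \<bar>odd_part D\<bar>) \<in> {-1, 1}" by (rule Jacobi_values)
  show ?thesis using assms(1,2)
  proof (cases rule: disc_cases)
    case 1
    then show ?thesis using J by (simp add: kronecker_def)
  next
    case 2
    have "2 dvd D" using 2(1) by (rule dvd_trans[rotated]) simp
    then have "odd n" using assms(3) coprime_common_divisor[of n D 2] by auto
    then show ?thesis using J by (auto simp: kronecker_def sign4_def sign8_def)
  qed
qed

text \<open>Write \<open>D\<close> as a sign times a power of 2 times an odd \<open>u > 0\<close>:
  reciprocity handles \<open>u\<close>, and the supplementary laws give \<open>sign4 p\<close> for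
  the sign and \<open>sign8 p\<close> for each factor 2.\<close>

lemma Legendre_eq_kronecker:
  fixes p :: nat
  assumes "prime p" "2 < p" "\<not> int p dvd D"
  shows "Legendre D p = kronecker D p"
proof -
  define w where "w = odd_part D"
  define u where "u = nat \<bar>w\<bar>"
  have D0: "D \<noteq> 0" using assms(3) by auto
  have odd: "odd w" using odd_odd_part[OF D0] by (simp add: w_def)
  then have oddu: "odd u" by (simp add: u_def even_nat_iff)
  have oddp: "odd p" using assms prime_odd_nat by blast
  have "\<not> int p dvd w" using assms(3) odd_part_dvd[of D] unfolding w_def by (meson dvd_trans)
  then have "\<not> p dvd u" unfolding u_def by (simp flip: int_dvd_int_iff)
  then have r: "Legendre (int u) p = Jacobi p u * (if u mod 4 = 3 then sign4 p else 1)"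
    using Legendre_Jacobi_reciprocity assms oddu by blast
  have u4: "int u mod 4 = 3 \<longleftrightarrow> u mod 4 = 3"
    by (metis of_nat_eq_iff of_nat_mod of_nat_numeral)
  have "Legendre w p = Jacobi p u * (if w mod 4 = 3 then sign4 p else 1)"
  proof (cases "w < 0")
    case False
    then have "w = int u" by (simp add: u_def)
    then show ?thesis using r u4 by simp
  next
    case True
    then have w: "w = (-1) * int u" by (simp add: u_def)
    then have "Legendre w p = sign4 p * Legendre u p"
      using Legendre_mult Legendre_minus_one assms by metis
    \<comment> \<open>Negation exchanges the odd classes 1 and 3 modulo 4, so the additional
      \<open>sign4 p\<close> coming from -1 turns the correction for \<open>u\<close> into the one
      for \<open>w\<close>.\<close>
    moreover have "w mod 4 = 3 \<longleftrightarrow> u mod 4 \<noteq> 3"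
    proof -
      have "odd (int u)" using oddu by simp
      then have "int u mod 4 = 1 \<or> int u mod 4 = 3" by presburger
      then show ?thesis using w u4 by (auto simp: zmod_zminus1_eq_if)
    qed
    moreover have "sign4 p * sign4 p = 1" using oddp by (simp add: sign4_def)
    ultimately show ?thesis using r by auto
  qed
  moreover have "Legendre (2 ^ e) p = (if odd e then sign8 p else 1)" for e
  proof (induction e)
    case 0
    then show ?case using assms by simp
  next
    case (Suc e)
    have "sign8 p * sign8 p = 1" using oddp by (simp add: sign8_def)
    then show ?case using Suc Legendre_mult[OF assms(1,2), of 2 "2 ^ e"] Legendre_two[OF assms(1,2)] by auto
  qed
  moreover have "Legendre D p = Legendre (2 ^ multiplicity 2 D) p * Legendre w p"
    using Legendre_mult[OF assms(1,2)] odd_part_decompose[of D] unfolding w_def by metis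
  ultimately show ?thesis by (simp add: kronecker_def w_def u_def)
qed

text \<open>For odd \<open>p\<close> the symbol is the Legendre symbol. At \<open>p = 2\<close> the
  discriminant is odd, the symbol is (2/|D|), and the value -1 means that \<open>D\<close> is 3 or 5
  modulo 8, of which only 5 is 1 modulo 4.\<close>

lemma kronecker_eq_minus_one_imp_inert:
  assumes "prime p" "D mod 4 = 0 \<or> D mod 4 = 1" "\<not> int p dvd D" "kronecker D p = -1"
  shows "inert p D"
proof (cases "p = 2")
  case False
  then have p: "2 < p" using assms(1) prime_ge_2_nat[of p] by linarith
  have "Legendre D p = -1" using Legendre_eq_kronecker assms p by simp
  then show ?thesis using False assms(1) by (auto simp: inert_def Legendre_def split: if_splits)
next
  case True
  then have odd: "odd D" "D mod 4 = 1" "D \<noteq> 0" using assms by (simp, presburger, auto)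
  then have "multiplicity 2 D = 0" "odd_part D = D"
    by (simp_all add: odd_part_def not_dvd_imp_multiplicity_0)
  then have "sign8 \<bar>D\<bar> = -1"
    using assms(4) True odd Jacobi_2[of "nat \<bar>D\<bar>"] by (simp add: kronecker_def even_nat_iff)
  then have "\<bar>D\<bar> mod 8 \<noteq> 1 \<and> \<bar>D\<bar> mod 8 \<noteq> 7" using odd by (auto simp: sign8_def)
  moreover have "D mod 8 = 1 \<or> D mod 8 = 5" using odd by presburger
  moreover have "\<bar>D\<bar> mod 8 = 1 \<or> \<bar>D\<bar> mod 8 = 7" if "D mod 8 = 1"
    using that by (cases "D \<ge> 0") (simp_all add: zmod_zminus1_eq_if)
  ultimately show ?thesis using True by (auto simp: inert_def)
qed

text \<open>If every prime with symbol -1 had an even exponent in \<open>n\<close>, then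
  multiplicativity would give the symbol of \<open>n\<close> the value 1.\<close>

lemma kronecker_minus_one_imp_inert_prime_factor:
  fixes n :: nat
  assumes "D mod 4 = 0 \<or> D mod 4 = 1" "D \<noteq> 0" "n > 0" "coprime (int n) D" "kronecker D n = -1"
  shows "\<exists>p. inert p D \<and> odd (multiplicity p n)"
proof (rule ccontr)
  assume contra: "\<not> ?thesis"
  have "kronecker D 1 * kronecker D 1 = kronecker D 1" "kronecker D 1 \<in> {-1, 1}"
    using kronecker_mult_right[OF assms(2), of 1 1] kronecker_values[OF assms(1,2), of 1] by simp_all
  then have one: "kronecker D 1 = 1" by auto
  have pow: "kronecker D (x ^ k) = kronecker D x ^ k" for x k
    by (induction k) (simp_all add: one kronecker_mult_right[OF assms(2)])
  have prod: "kronecker D (prod f A) = (\<Prod>x\<in>A. kronecker D (f x))" for f and A :: "nat set"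
    by (induction A rule: infinite_finite_induct) (simp_all add: one kronecker_mult_right[OF assms(2)])
  have "int n = int (\<Prod>p\<in>prime_factors n. p ^ multiplicity p n)"
    by (rule arg_cong[OF prime_factorization_nat[OF assms(3)]])
  then have "int n = (\<Prod>p\<in>prime_factors n. int p ^ multiplicity p n)"
    by (simp only: of_nat_prod of_nat_power)
  then have "kronecker D n = (\<Prod>p\<in>prime_factors n. kronecker D p ^ multiplicity p n)"
    by (simp add: prod pow)
  also have "\<dots> = 1"
  proof (rule prod.neutral, intro ballI)
    fix p assume "p \<in> prime_factors n"
    then have p: "prime p" "p dvd n" by auto
    then have cop: "coprime (int p) D" using assms(4) by (meson coprime_divisors dvd_refl int_dvd_int_iff)
    then have "\<not> int p dvd D" using p by (auto dest: coprime_common_divisor)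
    show "kronecker D p ^ multiplicity p n = 1"
    proof (cases "kronecker D p = -1")
      case True
      then have "inert p D"
        using kronecker_eq_minus_one_imp_inert[OF p(1) assms(1) \<open>\<not> int p dvd D\<close>] by simp
      then have "even (multiplicity p n)" using contra by blast
      then show ?thesis by (simp add: True)
    next
      case False
      then have "kronecker D p = 1" using kronecker_values[OF assms(1,2) cop] by auto
      then show ?thesis by simp
    qed
  qed
  finally show False using assms(5) by simp
qed

section \<open>Values -1: one symbol, then all symbols simultaneously\<close>

lemma exists_Legendre_minus_one:
  fixes q :: nat
  assumes "prime q" "2 < q"
  shows "\<exists>r :: nat. Legendre r q = -1"
proof (rule ccontr)
  assume contra: "\<not> ?thesis"
  let ?f = "\<lambda>y :: int. y ^ 2 mod int q"
  have "{0..<int q} \<subseteq> ?f ` {0..<int q}"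
  proof
    fix x assume x: "x \<in> {0..<int q}"
    have "QuadRes (int q) x"
    proof (cases "[x = 0] (mod int q)")
      case True
      then show ?thesis unfolding QuadRes_def by (intro exI[of _ 0]) (simp add: cong_sym_eq)
    next
      case False
      have "Legendre (int (nat x)) q \<noteq> -1" using contra by blast
      then show ?thesis using False x by (auto simp: Legendre_def split: if_splits)
    qed
    then obtain y where y: "[y\<^sup>2 = x] (mod int q)" by (auto simp: QuadRes_def)
    have "?f (y mod int q) = x"
      using y x by (simp add: unique_euclidean_semiring_class.cong_def power_mod)
    moreover have "y mod int q \<in> {0..<int q}" using assms by simp
    ultimately show "x \<in> ?f ` {0..<int q}" by blast
  qed
  \<comment> \<open>If every residue is a square, squaring is onto a finite set and hence injective;
    but 1 and \<open>q - 1\<close> have equal squares.\<close>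
  then have inj: "inj_on ?f {0..<int q}"
    by (intro eq_card_imp_inj_on antisym card_image_le card_mono) auto
  have eq: "?f 1 = ?f (int q - 1)"
  proof -
    have "[(int q - 1)\<^sup>2 = 1\<^sup>2] (mod int q)"
      by (simp add: cong_iff_dvd_diff power2_eq_square algebra_simps)
    then show ?thesis by (simp add: unique_euclidean_semiring_class.cong_def)
  qed
  have "1 = int q - 1" using inj_onD[OF inj eq] assms by simp
  then show False using assms by simp
qed

lemma prod_mset_single_value:
  fixes f :: "'a \<Rightarrow> 'b :: comm_monoid_mult"
  assumes "\<And>x. x \<in># M \<Longrightarrow> x \<noteq> q \<Longrightarrow> f x = 1"
  shows "(\<Prod>x\<in>#M. f x) = f q ^ count M q"
  using assms by (induction M) auto

text \<open>A nonsquare \<open>N\<close> shows itself in one of three ways: a prime \<open>q\<close>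
  has odd exponent in its odd part, or that part is a square up to sign and \<open>N\<close> is
  negative, or it is a square and the exponent of 2 is odd. The Chinese remainder theorem makes
  exactly this feature visible: a nonresidue modulo \<open>q\<close> in the first case, a class
  modulo 8 in the others.\<close>

lemma exists_kronecker_minus_one:
  fixes N :: int and M :: nat
  assumes "N \<noteq> 0" "\<not> is_square N" "M > 0"
  shows "\<exists>n::nat. coprime n M \<and> odd n \<and> kronecker N n = -1"
proof -
  define w where "w = odd_part N"
  define u where "u = nat \<bar>w\<bar>"
  define e where "e = multiplicity 2 N"
  have oddw: "odd w" using odd_odd_part assms(1) by (simp add: w_def)
  then have oddu: "odd u" by (simp add: u_def even_nat_iff)
  then have u0: "u > 0" by (rule odd_pos)
  have chi: "kronecker N n = Jacobi n u * (if w mod 4 = 3 then sign4 n else 1) * (if odd e then sign8 n else 1)" for n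
    by (simp add: kronecker_def w_def u_def e_def)
  show ?thesis
  proof (cases "\<exists>q. prime q \<and> odd (multiplicity q u)")
    case True
    then obtain q where q: "prime q" "odd (multiplicity q u)" by blast
    have "q dvd u"
    proof (rule ccontr)
      assume "\<not> q dvd u"
      then have "multiplicity q u = 0" by (rule not_dvd_imp_multiplicity_0)
      then show False using q(2) by simp
    qed
    then have q2: "2 < q" using q(1) oddu prime_ge_2_nat[of q] by (cases "q = 2") auto
    obtain r :: nat where r: "Legendre r q = -1" using exists_Legendre_minus_one q(1) q2 by blast
    \<comment> \<open>\<open>K\<close> is the part of \<open>M * u\<close> prime to
      \<open>q\<close>. Taking \<open>n\<close> to be 1 modulo \<open>8 * K\<close> neutralises both
      sign factors and every prime other than \<open>q\<close>.\<close>
    obtain K where K: "M * u = q ^ multiplicity q (M * u) * K" "\<not> q dvd K"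
    proof (rule multiplicity_decompose')
      show "M * u \<noteq> 0" using assms(3) u0 by simp
      show "\<not> is_unit q" using q(1) not_prime_unit by blast
    qed
    have "coprime (8 * K) q"
    proof -
      have "\<not> q dvd 8"
      proof
        assume "q dvd 8"
        then have "q dvd 2 ^ 3" by simp
        then have "q dvd 2" using q(1) prime_dvd_power by blast
        then show False using q2 by (auto dest: dvd_imp_le)
      qed
      then have "\<not> q dvd 8 * K" using K(2) q(1) prime_dvd_mult_iff by blast
      then show ?thesis using q(1) prime_imp_coprime coprime_commute by blast
    qed
    then obtain n where n: "[n = 1] (mod 8 * K)" "[n = r] (mod q)"
      using binary_chinese_remainder_nat by blast
    have L: "Legendre n q = -1"
      using Legendre_cong[of "int n" "int r" "int q"] n(2) r by (simp add: cong_int_iff)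
    have nq: "\<not> q dvd n"
    proof
      assume "q dvd n"
      then have "[int n = 0] (mod int q)" by (simp add: cong_0_iff)
      then show False using L by (simp add: Legendre_def)
    qed
    have copK: "coprime n (8 * K)"
      using cong_imp_coprime[OF cong_sym[OF n(1)]] by simp
    have "coprime n (q ^ multiplicity q (M * u) * K)"
      using copK nq q(1) prime_imp_coprime coprime_commute by auto
    then have "coprime n (M * u)" using K(1) by metis
    then have "coprime n M" by simp
    moreover have "odd n" using copK by (auto simp: coprime_right_2_iff_odd)
    moreover have "kronecker N n = -1"
    proof -
      have "[n = 1] (mod 8)" using n(1) by (rule cong_modulus_mult_nat)
      then have "n mod 8 = 1" by (simp add: unique_euclidean_semiring_class.cong_def)
      then have "int n mod 8 = 1" by (metis of_nat_1 of_nat_mod of_nat_numeral)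
      then have "int n mod 4 = 1" "odd (int n)" by presburger+
      have "Legendre n q' = 1" if "q' \<in># prime_factorization u" "q' \<noteq> q" for q'
      proof -
        have q': "prime q'" "q' dvd u" using that(1) by auto
        then have "q' dvd q ^ multiplicity q (M * u) * K" using K(1) by (metis dvd_mult)
        moreover have "\<not> q' dvd q ^ multiplicity q (M * u)"
          using q' q(1) that(2) prime_dvd_power primes_dvd_imp_eq by blast
        ultimately have "q' dvd K" using q'(1) prime_dvd_mult_iff by blast
        then have "[n = 1] (mod q')" using n(1) by (meson cong_dvd_modulus_nat dvd_mult)
        then have "[int n = 1] (mod int q')" by (metis cong_int_iff of_nat_1)
        then have "Legendre n q' = Legendre 1 q'" by (rule Legendre_cong)
        then show ?thesis using q'(1) prime_gt_1_nat[of q'] by simp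
      qed
      then have "Jacobi n u = Legendre n q ^ count (prime_factorization u) q"
        unfolding Jacobi_def by (intro prod_mset_single_value) auto
      also have "\<dots> = -1"
        using q L by (simp add: count_prime_factorization)
      finally have "Jacobi n u = -1" .
      then show ?thesis
        using \<open>int n mod 8 = 1\<close> \<open>int n mod 4 = 1\<close> \<open>odd (int n)\<close> by (simp add: chi sign4_def sign8_def)
    qed
    ultimately show ?thesis by blast
  next
    case False
    then have "is_square u" by (auto simp: is_nth_power_conv_multiplicity_nat)
    then obtain s where s: "u = s\<^sup>2" by (auto elim: is_nth_powerE)
    have oddM: "odd (M * u div 2 ^ multiplicity 2 (M * u))"
      using multiplicity_decompose[of "M * u" 2] assms(3) u0 by auto
    define K where "K = M * u div 2 ^ multiplicity 2 (M * u)"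
    have MK: "M * u = 2 ^ multiplicity 2 (M * u) * K"
      unfolding K_def by (simp add: multiplicity_dvd)
    have "odd K" using oddM by (simp add: K_def)
    then have "coprime (2 ^ 3) K" using coprime_power_left_iff coprime_left_2_iff_odd by blast
    then have cop8: "coprime 8 K" by simp
    have key: "\<exists>n::nat. coprime n M \<and> odd n \<and> n mod 8 = c \<and> Jacobi n u = 1" if c: "odd c" "c < 8" for c
    proof -
      obtain n where n: "[n = c] (mod 8)" "[n = 1] (mod K)"
        using binary_chinese_remainder_nat[OF cop8] by blast
      have n8: "n mod 8 = c" using n(1) c by (simp add: unique_euclidean_semiring_class.cong_def)
      have "odd n" using n8 c by presburger
      moreover have "coprime n K" using cong_imp_coprime[OF cong_sym[OF n(2)]] by simp
      ultimately have "coprime n (M * u)" using MK by (metis coprime_mult_right_iff coprime_power_right_iff coprime_right_2_iff_odd)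
      then have "coprime n M" "coprime n u" by simp_all
      have "Jacobi n u = Jacobi n s * Jacobi n s"
        using u0 s by (simp add: power2_eq_square Jacobi_mult_right)
      moreover have "Jacobi n s \<in> {-1, 1}"
        using \<open>coprime n u\<close> s by (intro Jacobi_values) simp
      ultimately have "Jacobi n u = 1" by auto
      then show ?thesis using \<open>coprime n M\<close> \<open>odd n\<close> n8 by blast
    qed
    have "odd s" using s oddu by simp
    then obtain t where "s = 2 * t + 1" by (elim oddE)
    then have "u = 4 * (t * t + t) + 1" using s by (simp add: power2_eq_square algebra_simps)
    then have u4: "int u = 4 * int (t * t + t) + 1" by simp
    show ?thesis
    proof (cases "w < 0")
      case True
      then have "w = - int u" by (simp add: u_def)
      then have w4: "w mod 4 = 3" using u4 by presburger
      \<comment> \<open>The class 7 is 3 modulo 4 while \<open>sign8\<close> is 1 on it, so only the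
        sign of \<open>N\<close> is felt, whatever the parity of \<open>e\<close>.\<close>
      obtain n :: nat where n: "coprime n M" "odd n" "n mod 8 = 7" "Jacobi n u = 1"
        using key[of 7] by auto
      have "int n mod 8 = 7" using n(3) by (metis of_nat_mod of_nat_numeral)
      moreover from this have "int n mod 4 = 3" by presburger
      ultimately have "kronecker N n = -1"
        using n w4 by (simp add: chi sign4_def sign8_def)
      then show ?thesis using n by blast
    next
      case False
      then have w: "w = int u" by (simp add: u_def)
      then have w4: "w mod 4 = 1" using u4 by presburger
      have "odd e"
      proof
        assume "even e"
        then obtain k where k: "e = 2 * k" by (elim evenE)
        have "N = (2 ^ k * int s)\<^sup>2"
          using odd_part_decompose[of N] w s k
          by (simp add: w_def e_def power_mult_distrib flip: power_mult)
        then show False using assms(2) by (auto intro: is_nth_powerI)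
      qed
      \<comment> \<open>On the class 5 \<open>sign8\<close> is -1, and \<open>e\<close> is odd; as
        \<open>w mod 4 = 1\<close>, there is no factor \<open>sign4\<close>.\<close>
      obtain n :: nat where n: "coprime n M" "odd n" "n mod 8 = 5" "Jacobi n u = 1"
        using key[of 5] by auto
      have "int n mod 8 = 5" using n(3) by (metis of_nat_mod of_nat_numeral)
      then have "kronecker N n = -1"
        using n w4 \<open>odd e\<close> by (simp add: chi sign8_def)
      then show ?thesis using n by blast
    qed
  qed
qed

text \<open>Expanding \<open>\<Prod>\<^sub>x (1 - \<psi>\<^sub>x n)\<close> and summing over \<open>n\<close>, the terms of odd size vanish,
  those of even size are nonnegative, and the empty one is positive.\<close>
lemma exists_common_minus_one:
  fixes \<psi> :: "'a \<Rightarrow> nat \<Rightarrow> int"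
  assumes "finite S" "M > 0"
    and mult: "\<And>x m n. x \<in> S \<Longrightarrow> \<psi> x (m * n) = \<psi> x m * \<psi> x n"
    and per: "\<And>x n. x \<in> S \<Longrightarrow> \<psi> x (n mod M) = \<psi> x n"
    and vals: "\<And>x n. x \<in> S \<Longrightarrow> coprime n M \<Longrightarrow> \<psi> x n \<in> {-1, 1}"
    and odd: "\<And>A. A \<subseteq> S \<Longrightarrow> odd (card A) \<Longrightarrow> \<exists>m. coprime m M \<and> (\<Prod>x\<in>A. \<psi> x m) = -1"
  shows "\<exists>n. coprime n M \<and> (\<forall>x\<in>S. \<psi> x n = -1)"
proof -
  define U where "U = {n. n < M \<and> coprime n M}"
  have finU: "finite U" unfolding U_def by simp
  define G where "G A = (\<Sum>n\<in>U. \<Prod>x\<in>A. \<psi> x n)" for A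
  have modU: "n mod M \<in> U" if "coprime n M" for n
    using that assms(2) by (simp add: U_def)
  \<comment> \<open>Multiplication by the unit \<open>m\<close> permutes \<open>U\<close> and
    changes the sign of every product, so \<open>G A = - G A\<close>.\<close>
  have G0: "G A = 0" if A: "A \<subseteq> S" "coprime m M" "(\<Prod>x\<in>A. \<psi> x m) = -1" for A m
  proof -
    let ?f = "\<lambda>n. (m * n) mod M"
    have maps: "?f ` U \<subseteq> U" 
    proof (rule image_subsetI)
      fix n assume "n \<in> U"
      then have "coprime (m * n) M" using A(2) by (simp add: U_def)
      then show "?f n \<in> U" by (rule modU)
    qed
    have inj: "inj_on ?f U"
    proof (rule inj_onI)
      fix a b assume ab: "a \<in> U" "b \<in> U" "?f a = ?f b"
      then have "[m * a = m * b] (mod M)" by (simp add: unique_euclidean_semiring_class.cong_def)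
      then have "[a = b] (mod M)" using A(2) cong_mult_lcancel_nat by blast
      then show "a = b" using ab by (simp add: U_def unique_euclidean_semiring_class.cong_def)
    qed
    then have "?f ` U = U" using maps finU by (simp add: endo_inj_surj)
    then have "G A = (\<Sum>n\<in>U. \<Prod>x\<in>A. \<psi> x (?f n))"
      unfolding G_def using sum.reindex[OF inj, of "\<lambda>n. \<Prod>x\<in>A. \<psi> x n"] by simp
    also have "\<dots> = (\<Sum>n\<in>U. - (\<Prod>x\<in>A. \<psi> x n))"
    proof (rule sum.cong[OF refl])
      fix n
      have "(\<Prod>x\<in>A. \<psi> x (?f n)) = (\<Prod>x\<in>A. \<psi> x m * \<psi> x n)"
        using A(1) mult per by (intro prod.cong) auto
      then show "(\<Prod>x\<in>A. \<psi> x (?f n)) = - (\<Prod>x\<in>A. \<psi> x n)"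
        using A(3) by (simp add: prod.distrib)
    qed
    also have "\<dots> = - G A" by (simp add: G_def sum_negf)
    finally show ?thesis by simp
  qed
  have pm: "(\<Prod>x\<in>A. \<psi> x n) \<in> {-1, 1}" if "A \<subseteq> S" "coprime n M" for A n
    using that(1)
  proof (induction A rule: infinite_finite_induct)
    case (insert x A)
    then have "\<psi> x n \<in> {-1, 1}" using vals that(2) by auto
    then show ?case using insert by auto
  qed auto
  \<comment> \<open>If the product never takes the value -1 on units, it is constantly 1 there, so
    \<open>G A\<close> is nonnegative, and the hypothesis on odd sets makes the sign in front
    +1.\<close>
  have Gnn: "(-1) ^ card A * G A \<ge> 0" if A: "A \<subseteq> S" for A
  proof (cases "\<exists>m. coprime m M \<and> (\<Prod>x\<in>A. \<psi> x m) = -1")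
    case True
    then show ?thesis using G0 A by auto
  next
    case False
    then have "(\<Prod>x\<in>A. \<psi> x n) = 1" if "n \<in> U" for n
      using pm[OF A, of n] that by (auto simp: U_def)
    then have "G A \<ge> 0" unfolding G_def by (intro sum_nonneg) simp
    moreover have "even (card A)" using False odd A by blast
    ultimately show ?thesis by simp
  qed
  have "1 mod M \<in> U" by (rule modU) simp
  then have "card U > 0" using finU card_gt_0_iff by blast
  then have "0 < (-1) ^ card ({} :: 'a set) * G {}" by (simp add: G_def)
  also have "\<dots> \<le> (\<Sum>A\<in>Pow S. (-1) ^ card A * G A)"
    using assms(1) Gnn by (intro member_le_sum) auto
  also have "\<dots> = (\<Sum>n\<in>U. \<Sum>A\<in>Pow S. (-1) ^ card A * (\<Prod>x\<in>A. \<psi> x n))"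
    unfolding G_def sum_distrib_left by (rule sum.swap)
  also have "\<dots> = (\<Sum>n\<in>U. \<Prod>x\<in>S. 1 - \<psi> x n)"
  proof (rule sum.cong[OF refl])
    fix n
    have "(\<Prod>x\<in>S. 1 - \<psi> x n) = (\<Prod>x\<in>S. - \<psi> x n + 1)" by simp
    also have "\<dots> = (\<Sum>A\<in>Pow S. (\<Prod>x\<in>A. - \<psi> x n) * (\<Prod>x\<in>S - A. 1))"
      by (rule prod_add[OF assms(1)])
    finally show "(\<Sum>A\<in>Pow S. (-1) ^ card A * (\<Prod>x\<in>A. \<psi> x n)) = (\<Prod>x\<in>S. 1 - \<psi> x n)"
      by (simp add: prod_uminus)
  qed
  finally have "(\<Sum>n\<in>U. \<Prod>x\<in>S. 1 - \<psi> x n) \<noteq> 0" by simp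
  then obtain n where n: "n \<in> U" "(\<Prod>x\<in>S. 1 - \<psi> x n) \<noteq> 0"
    by (rule sum.not_neutral_contains_not_neutral)
  then have "\<psi> x n = -1" if "x \<in> S" for x
    using that vals[OF that, of n] assms(1) by (auto simp: U_def)
  then show ?thesis using n(1) by (auto simp: U_def)
qed

text \<open>For an odd subset the nonsquare product has a symbol equal to -1 at some odd unit, where
  the symbol splits into those of the single \<open>D\<close>. The resulting class modulo
  \<open>8 * d\<close> may be read modulo \<open>d\<close>, since each symbol has period
  \<open>D\<close> and \<open>D\<close> divides \<open>d\<close>.\<close>

lemma exists_common_inert_class:
  fixes \<D> :: "int set" and d :: nat
  assumes "finite \<D>" and disc: "\<And>D. D \<in> \<D> \<Longrightarrow> D mod 4 = 0 \<or> D mod 4 = 1"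
    and nonsq: "\<And>\<A>. \<A> \<subseteq> \<D> \<Longrightarrow> odd (card \<A>) \<Longrightarrow> \<not> is_square (\<Prod>D\<in>\<A>. D)"
    and d: "d > 0" "\<And>D. D \<in> \<D> \<Longrightarrow> D dvd int d"
  shows "\<exists>a. coprime a d \<and> (\<forall>n D. n > 0 \<longrightarrow> [n = a] (mod d) \<longrightarrow> D \<in> \<D> \<longrightarrow>
           (\<exists>p. inert p D \<and> odd (multiplicity p n)))"
proof -
  have D0: "D \<noteq> 0" if "D \<in> \<D>" for D using d that by fastforce
  have cop: "coprime (int n) D" if "D \<in> \<D>" "coprime n d" for n D
    using coprime_divisors[OF dvd_refl d(2)[OF that(1)], of "int n"] that(2) by simp
  have "\<exists>n. coprime n (8 * d) \<and> (\<forall>D\<in>\<D>. kronecker D (int n) = -1)"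
  proof (rule exists_common_minus_one[OF assms(1)])
    show "8 * d > 0" using d by simp
    show "kronecker D (int (m * n)) = kronecker D (int m) * kronecker D (int n)" if "D \<in> \<D>" for D m n
      using kronecker_mult_right D0[OF that] by simp
    show "kronecker D (int (n mod (8 * d))) = kronecker D (int n)" if "D \<in> \<D>" for D n
    proof (rule kronecker_cong[OF disc D0])
      have "D dvd int (8 * d)" using d(2)[OF that] by simp
      moreover have "[int (n mod (8 * d)) = int n] (mod int (8 * d))"
        unfolding cong_int_iff by (simp add: unique_euclidean_semiring_class.cong_def)
      ultimately show "[int (n mod (8 * d)) = int n] (mod D)" using cong_dvd_modulus by blast
    qed (use that in auto)
    show "kronecker D (int n) \<in> {-1, 1}" if "D \<in> \<D>" "coprime n (8 * d)" for D n
      using kronecker_values disc D0 cop that by simp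
  next
    fix A assume A: "A \<subseteq> \<D>" "odd (card A)"
    have fin: "finite A" using A(1) assms(1) finite_subset by blast
    then have "(\<Prod>D\<in>A. D) \<noteq> 0" using A(1) D0 by auto
    then obtain n :: nat where "coprime n (8 * d)" "odd n" "kronecker (\<Prod>D\<in>A. D) n = -1"
      using exists_kronecker_minus_one[of "\<Prod>D\<in>A. D" "8 * d"] nonsq[OF A] d by auto
    moreover have "kronecker (\<Prod>D\<in>A. D) n = (\<Prod>D\<in>A. kronecker D n)" if "odd n" for n :: nat
      using kronecker_prod[of A "int n"] D0 A(1) that by fastforce
    ultimately show "\<exists>m. coprime m (8 * d) \<and> (\<Prod>D\<in>A. kronecker D (int m)) = -1"
      by metis
  qed
  then obtain a where a: "coprime a (8 * d)" "\<And>D. D \<in> \<D> \<Longrightarrow> kronecker D (int a) = -1" by blast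
  have "\<exists>p. inert p D \<and> odd (multiplicity p n)" if "n > 0" "[n = a] (mod d)" "D \<in> \<D>" for n D
  proof (rule kronecker_minus_one_imp_inert_prime_factor)
    have "coprime n d" using a(1) that(2) cong_imp_coprime cong_sym by (metis coprime_mult_right_iff)
    then show "coprime (int n) D" using cop that by blast
    have "[int n = int a] (mod D)" using that d(2) by (meson cong_dvd_modulus cong_int_iff)
    then show "kronecker D (int n) = -1" using kronecker_cong disc D0 a(2) that by metis
  qed (use that disc D0 in auto)
  then show ?thesis using a(1) by (intro exI[of _ a]) auto
qed

section \<open>Inert primes and represented integers\<close>

text \<open>For odd \<open>p\<close>, 4aQ = (2ax + by)^2 - D y^2: if \<open>p\<close> did not divide
  \<open>y\<close>, then \<open>D\<close> would be a square modulo \<open>p\<close>. So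
  \<open>p\<close> divides \<open>y\<close> and \<open>a * x^2\<close>, and it does not divide
  \<open>a\<close>, since otherwise \<open>D\<close> is congruent to \<open>b^2\<close>. For
  \<open>p = 2\<close> the condition 5 modulo 8 makes \<open>a\<close>, \<open>b\<close>,
  \<open>c\<close> all odd, and then the form is even only if \<open>x\<close> and \<open>y\<close>
  both are.\<close>

lemma inert_dvd_bqf:
  assumes "inert p (bqf_disc a b c)" "int p dvd bqf a b c x y"
  shows "int p dvd x \<and> int p dvd y"
proof (cases "p = 2")
  case True
  then have D8: "(b\<^sup>2 - 4 * a * c) mod 8 = 5" using assms(1) by (simp add: inert_def bqf_disc_def)
  have oddD: "odd (b\<^sup>2 - 4 * a * c)"
  proof
    assume "even (b\<^sup>2 - 4 * a * c)"
    then show False using D8 by presburger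
  qed
  then have oddb: "odd b" by simp
  then obtain t where t: "b = 2 * t + 1" by (elim oddE)
  have "even (t * (t + 1))" by simp
  then obtain r where r: "t * (t + 1) = 2 * r" by (elim evenE)
  have "b\<^sup>2 = 4 * (t * (t + 1)) + 1" by (simp add: t power2_eq_square algebra_simps)
  then have b2: "b\<^sup>2 - 4 * a * c = 8 * r + 1 - 4 * (a * c)" using r by simp
  have "odd (a * c)"
  proof
    assume "even (a * c)"
    then obtain v where "a * c = 2 * v" by (elim evenE)
    then have "b\<^sup>2 - 4 * a * c = 8 * (r - v) + 1" using b2 by simp
    moreover have "(8 * (r - v) + 1) mod 8 = 1" by presburger
    ultimately have "(b\<^sup>2 - 4 * a * c) mod 8 = 1" by metis
    then show False using D8 by simp
  qed
  then have "odd a" "odd c" by auto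
  moreover have "even (a * x\<^sup>2 + b * x * y + c * y\<^sup>2)" using assms(2) True by (simp add: bqf_def)
  ultimately show ?thesis using oddb True by auto
next
  case False
  define P where "P = int p"
  have pr: "prime P" and nq: "\<not> QuadRes P (b\<^sup>2 - 4 * a * c)"
    using assms(1) False by (simp_all add: inert_def P_def bqf_disc_def)
  have dvd: "P dvd a * x\<^sup>2 + b * x * y + c * y\<^sup>2"
    using assms(2) by (simp add: P_def bqf_def)
  have Py: "P dvd y"
  proof (rule ccontr)
    assume "\<not> P dvd y"
    then have "coprime y P" using pr by (metis coprime_commute prime_imp_coprime)
    then obtain z where z: "[y * z = 1] (mod P)" using cong_solve_coprime_int by blast
    have "4 * a * (a * x\<^sup>2 + b * x * y + c * y\<^sup>2) = (2 * a * x + b * y)\<^sup>2 - (b\<^sup>2 - 4 * a * c) * y\<^sup>2"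
      by (simp add: power2_eq_square algebra_simps)
    then have "P dvd (2 * a * x + b * y)\<^sup>2 - (b\<^sup>2 - 4 * a * c) * y\<^sup>2"
      using dvd by (metis dvd_mult)
    then have "[(2 * a * x + b * y)\<^sup>2 = (b\<^sup>2 - 4 * a * c) * y\<^sup>2] (mod P)"
      by (simp add: cong_iff_dvd_diff)
    then have "[(2 * a * x + b * y)\<^sup>2 * z\<^sup>2 = (b\<^sup>2 - 4 * a * c) * y\<^sup>2 * z\<^sup>2] (mod P)"
      by (rule cong_scalar_right)
    moreover have "[(b\<^sup>2 - 4 * a * c) * (y * z)\<^sup>2 = (b\<^sup>2 - 4 * a * c) * 1\<^sup>2] (mod P)"
      using z by (intro cong_mult cong_pow cong_refl)
    ultimately have "[((2 * a * x + b * y) * z)\<^sup>2 = b\<^sup>2 - 4 * a * c] (mod P)"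
      by (simp add: power_mult_distrib ac_simps) (meson cong_trans)
    then show False using nq by (auto simp: QuadRes_def)
  qed
  then have "P dvd b * x * y + c * y\<^sup>2" by (simp add: power2_eq_square)
  then have "P dvd a * x\<^sup>2" using dvd by (metis add.assoc dvd_add_left_iff)
  moreover have "\<not> P dvd a"
  proof
    assume "P dvd a"
    then have "[b\<^sup>2 = b\<^sup>2 - 4 * a * c] (mod P)" by (simp add: cong_iff_dvd_diff)
    then show False using nq by (auto simp: QuadRes_def)
  qed
  ultimately have "P dvd x" using pr prime_dvd_mult_iff prime_dvd_power by blast
  then show ?thesis using Py by (simp add: P_def)
qed

text \<open>Descent: if \<open>p\<close> divides the value, it divides both variables, and removing
  it from them leaves a smaller value of the same form with exponent lower by 2.\<close>

lemma even_multiplicity_inert: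
  assumes "inert p (bqf_disc a b c)" "bqf a b c x y = int n" "n > 0"
  shows "even (multiplicity p n)"
  using assms(2,3)
proof (induction n arbitrary: x y rule: less_induct)
  case (less n)
  have p: "prime p" using assms(1) by (rule inert_prime)
  show ?case
  proof (cases "p dvd n")
    case False
    then show ?thesis by (simp add: not_dvd_imp_multiplicity_0)
  next
    case True
    then obtain x' y' where xy: "x = int p * x'" "y = int p * y'"
      using inert_dvd_bqf[OF assms(1), of x y] less.prems(1) by (auto elim!: dvdE)
    have n: "int n = int (p * p) * bqf a b c x' y'"
      using less.prems(1) by (simp add: xy bqf_def power2_eq_square algebra_simps)
    define m where "m = nat (bqf a b c x' y')"
    have "int n > 0" using less.prems(2) by simp
    then have "bqf a b c x' y' > 0"
      unfolding n using p prime_gt_0_nat by (simp add: zero_less_mult_iff)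
    then have m: "bqf a b c x' y' = int m" "m > 0" by (simp_all add: m_def)
    then have nm: "n = p * (p * m)" using n by (metis mult.assoc of_nat_eq_iff of_nat_mult)
    have "1 < p * p" using prime_gt_1_nat[OF p] less_1_mult by blast
    then have "m < n" using m(2) nm by (simp flip: mult.assoc)
    then have "even (multiplicity p m)" using less.IH m by blast
    moreover have "multiplicity p n = Suc (Suc (multiplicity p m))"
      using p m(2) prime_gt_0_nat[OF p] by (simp add: nm prime_elem_multiplicity_mult_distrib)
    ultimately show ?thesis by simp
  qed
qed

lemma not_represented:
  assumes "\<And>D. D \<in> \<D> \<Longrightarrow> \<exists>p. inert p D \<and> odd (multiplicity p n)"
  shows "n \<notin> represented_set \<D>"
  using assms even_multiplicity_inert unfolding represented_set_def by blast

section \<open>Chebyshev estimates\<close>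

lemma prod_primes_dvd:
  fixes A :: "nat set"
  assumes "finite A" "\<And>p. p \<in> A \<Longrightarrow> prime p" "\<And>p. p \<in> A \<Longrightarrow> p dvd n"
  shows "\<Prod>A dvd n"
  using assms
proof (induction A)
  case (insert p A)
  have "\<not> p dvd \<Prod>A"
  proof
    assume "p dvd \<Prod>A"
    then obtain q where "q \<in> A" "p dvd q"
      using insert prime_dvd_prod_iff[of A p "\<lambda>x. x"] by auto
    then have "p = q" using insert.prems primes_dvd_imp_eq by blast
    then show False using \<open>q \<in> A\<close> insert by simp
  qed
  then have "coprime p (\<Prod>A)" using insert by (simp add: prime_imp_coprime)
  then show ?case using insert by (simp add: divides_mult)
qed simp

text \<open>Erdos's argument: for \<open>n = 2 * m + 1\<close> the primes in
  \<open>(m + 1, n]\<close> divide the binomial coefficient \<open>n choose m\<close>, and the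
  remaining ones are covered by induction.\<close>

lemma prod_primes_le_power_4:
  "\<Prod>{p. prime p \<and> p \<le> n} \<le> 4 ^ (n :: nat)"
proof (induction n rule: less_induct)
  case (less n)
  have fin: "finite {p. prime p \<and> p \<le> m}" for m :: nat by simp
  consider "n \<le> 1" | "n = 2" | "n > 2" "even n" | "n > 2" "odd n" by linarith
  then show ?case
  proof cases
    case 1
    then have "{p. prime p \<and> p \<le> n} = {}" by (auto dest!: prime_ge_2_nat)
    then show ?thesis by (simp only: prod.empty) simp
  next
    case 2
    have "{p::nat. prime p \<and> p \<le> 2} = {2}" using prime_ge_2_nat by (auto intro: antisym)
    then show ?thesis by (simp add: 2)
  next
    case 3
    have "{p. prime p \<and> p \<le> n} = {p. prime p \<and> p \<le> n - 1}"
    proof -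
      have "\<not> prime n" using 3 prime_odd_nat by blast
      then have "p \<le> n \<longleftrightarrow> p \<le> n - 1" if "prime p" for p
        using that 3 by (cases "p = n") auto
      then show ?thesis by blast
    qed
    then have "\<Prod>{p. prime p \<and> p \<le> n} \<le> 4 ^ (n - 1)" using less[of "n - 1"] 3 by simp
    also have "\<dots> \<le> 4 ^ n" by (intro power_increasing) auto
    finally show ?thesis .
  next
    case 4
    then obtain m where m: "n = 2 * m + 1" by (elim oddE)
    then have "m > 0" using 4 by simp
    define A where "A = {p. prime p \<and> m + 1 < p \<and> p \<le> n}"
    have "\<Prod>A dvd n choose m"
    proof (rule prod_primes_dvd)
      show "finite A" by (simp add: A_def)
      fix p assume p: "p \<in> A"
      then show "prime p" by (simp add: A_def)
      have "fact n = (n choose m) * (fact m * fact (n - m))"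
        using binomial_fact_lemma[of m n] m by (simp add: ac_simps)
      moreover have "p dvd fact n" "\<not> p dvd fact m" "\<not> p dvd fact (n - m)"
        using p m by (simp_all add: A_def prime_dvd_fact_iff del: fact_Suc)
      ultimately show "p dvd n choose m"
        using p by (auto simp: A_def prime_dvd_mult_iff)
    qed
    then have "\<Prod>A \<le> n choose m" using m by (intro dvd_imp_le) auto
    also have "\<dots> \<le> 4 ^ m"
    proof -
      \<comment> \<open>The row of the odd number \<open>n\<close> has two equal middle entries, so
        each is at most half of \<open>2 ^ n\<close>.\<close>
      have "2 * (n choose m) = (n choose m) + (n choose (m + 1))"
        using binomial_symmetric[of m n] m by simp
      also have "\<dots> = (\<Sum>k\<in>{m, m + 1}. n choose k)" by simp
      also have "\<dots> \<le> (\<Sum>k\<le>n. n choose k)" using m by (intro sum_mono2) auto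
      also have "\<dots> = 2 * 4 ^ m" using choose_row_sum[of n] m by (simp add: power_mult)
      finally show ?thesis by simp
    qed
    finally have A: "\<Prod>A \<le> 4 ^ m" .
    have "{p. prime p \<and> p \<le> n} = {p. prime p \<and> p \<le> m + 1} \<union> A"
      using m by (auto simp: A_def)
    then have "\<Prod>{p. prime p \<and> p \<le> n} = \<Prod>{p. prime p \<and> p \<le> m + 1} * \<Prod>A"
      by (simp add: A_def, subst prod.union_disjoint[symmetric]) auto
    also have "\<dots> \<le> 4 ^ (m + 1) * 4 ^ m"
      using less[of "m + 1"] m \<open>m > 0\<close> A by (intro mult_mono) auto
    also have "\<dots> = 4 ^ n" using m by (simp add: power_add flip: power_mult) (simp add: mult_2 power_add)
    finally show ?thesis .
  qed
qed

lemma sum_ln_primes_le: "(\<Sum>p | prime p \<and> p \<le> n. ln (real p)) \<le> real n * ln 4"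
proof -
  have "(\<Sum>p | prime p \<and> p \<le> n. ln (real p)) = ln (\<Prod>p | prime p \<and> p \<le> n. real p)"
    using prime_gt_0_nat by (intro ln_prod[symmetric]) auto
  also have "\<dots> = ln (real (\<Prod>{p. prime p \<and> p \<le> n}))" by simp
  also have "\<dots> \<le> ln (real (4 ^ n))"
    using prod_primes_le_power_4[of n] prime_gt_0_nat
    by (subst ln_le_cancel_iff) (auto intro!: prod_pos simp del: of_nat_prod of_nat_power)
  also have "\<dots> = real n * ln 4" by (simp add: ln_realpow)
  finally show ?thesis .
qed

text \<open>Split at the square root \<open>s\<close> of \<open>n\<close>: at most \<open>s\<close>
  primes lie below, and each prime above contributes at least \<open>ln s\<close> to the sum of
  \<open>ln p\<close>. With \<open>ln 4 \<le> 3 / 2\<close> and \<open>ln n = 2 * ln s\<close> the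
  constant is 2 (1 + 3/2) = 5.\<close>

lemma card_primes_mult_ln_le:
  fixes n :: nat
  assumes "n \<ge> 1"
  shows "real (card {p. prime p \<and> p \<le> n}) * ln n \<le> 5 * n"
proof -
  let ?P = "{p. prime p \<and> p \<le> n}"
  define s where "s = sqrt (real n)"
  have s: "s \<ge> 1" "s * s = real n" using assms by (simp_all add: s_def)
  have lns: "ln (real n) = 2 * ln s" using s ln_mult[of s s] by simp
  have lns_le: "ln s \<le> s" using ln_le_minus_one[of s] s by linarith
  have lns0: "ln s \<ge> 0" using s by simp
  have "card ?P \<le> card (?P \<inter> {p. real p \<le> s}) + card (?P \<inter> {p. real p > s})"
    by (subst card_Un_disjoint[symmetric]) (auto intro!: card_mono)
  moreover have "real (card (?P \<inter> {p. real p \<le> s})) \<le> s"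
  proof -
    have "card (?P \<inter> {p. real p \<le> s}) \<le> card {1..nat \<lfloor>s\<rfloor>}"
      using prime_ge_1_nat by (intro card_mono) (auto simp: le_nat_floor)
    then have "card (?P \<inter> {p. real p \<le> s}) \<le> nat \<lfloor>s\<rfloor>" by simp
    then show ?thesis using s by linarith
  qed
  moreover have "real (card (?P \<inter> {p. real p > s})) * ln s \<le> real n * ln 4"
  proof -
    have "real (card (?P \<inter> {p. real p > s})) * ln s = (\<Sum>p\<in>?P \<inter> {p. real p > s}. ln s)" by simp
    also have "\<dots> \<le> (\<Sum>p\<in>?P \<inter> {p. real p > s}. ln (real p))"
      using s by (intro sum_mono) auto
    also have "\<dots> \<le> (\<Sum>p\<in>?P. ln (real p))"
      using prime_ge_1_nat by (intro sum_mono2) auto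
    also have "\<dots> \<le> real n * ln 4" by (rule sum_ln_primes_le)
    finally show ?thesis .
  qed
  ultimately have "real (card ?P) * ln s \<le> s * ln s + real n * ln 4"
  proof -
    assume c: "card ?P \<le> card (?P \<inter> {p. real p \<le> s}) + card (?P \<inter> {p. real p > s})"
      and 1: "real (card (?P \<inter> {p. real p \<le> s})) \<le> s"
      and 2: "real (card (?P \<inter> {p. real p > s})) * ln s \<le> real n * ln 4"
    have "real (card ?P) \<le> s + real (card (?P \<inter> {p. real p > s}))" using c 1 by linarith
    then have "real (card ?P) * ln s \<le> (s + real (card (?P \<inter> {p. real p > s}))) * ln s"
      using lns0 by (rule mult_right_mono)
    then show ?thesis using 2 by (simp add: distrib_right)
  qed
  also have "s * ln s \<le> real n" using lns_le s mult_left_mono[of "ln s" s s] by simp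
  also have "ln (4::real) \<le> 3 / 2"
  proof -
    have "ln (4::real) = 2 * ln 2" using ln_realpow[of 2 2] by simp
    then show ?thesis using ln2_le_25_over_36 by simp
  qed
  finally have "real (card ?P) * ln s \<le> real n + real n * (3 / 2)"
    by (simp add: mult_left_mono)
  then show ?thesis using lns by simp
qed

section \<open>Legendre's formula for factorials, and the prime divisors of an arithmetic
  progression\<close>

lemma multiplicity_fact_div:
  assumes "prime p"
  shows "multiplicity p (fact k :: nat) = k div p + multiplicity p (fact (k div p) :: nat)"
proof (induction k)
  case (Suc k)
  have p: "p > 1" using assms prime_gt_1_nat by blast
  have S: "multiplicity p (fact (Suc k) :: nat) = multiplicity p (Suc k) + multiplicity p (fact k :: nat)"
    using assms by (simp add: prime_elem_multiplicity_mult_distrib del: mult_Suc)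
  show ?case
  proof (cases "p dvd Suc k")
    case True
    then obtain q where q: "Suc k = p * q" by (elim dvdE)
    then have "q > 0" by (cases q) auto
    then obtain r where r: "q = Suc r" by (cases q) auto
    have "k = (p - 1) + p * r" using q r p by simp
    then have "k div p = r + (p - 1) div p" using p by (simp only: div_mult_self2)
    then have kr: "k div p = r" using p by simp
    have "multiplicity p (Suc k) = Suc (multiplicity p q)"
      using q \<open>q > 0\<close> p assms by (simp add: multiplicity_times_same not_prime_unit)
    moreover have "multiplicity p (fact q :: nat) = multiplicity p q + multiplicity p (fact r :: nat)"
      using assms by (simp add: r prime_elem_multiplicity_mult_distrib del: mult_Suc)
    moreover have "Suc k div p = q" using q p by simp
    ultimately show ?thesis using S Suc kr r by simp
  next
    case False
    then have "Suc k div p = k div p" by (simp add: div_Suc dvd_eq_mod_eq_0)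
    then show ?thesis using S Suc False by (simp add: not_dvd_imp_multiplicity_0)
  qed
qed simp

text \<open>With \<open>q = k div p\<close>, the recursion and induction give at most
  \<open>q * (p - 1) + q = q * p \<le> k\<close>.\<close>

lemma multiplicity_fact_le:
  assumes "prime p"
  shows "multiplicity p (fact k :: nat) * (p - 1) \<le> k"
proof (induction k rule: less_induct)
  case (less k)
  have p: "p > 1" using assms prime_gt_1_nat by blast
  show ?case
  proof (cases "k = 0")
    case False
    then have "multiplicity p (fact (k div p) :: nat) * (p - 1) \<le> k div p"
      using less p by simp
    then have "multiplicity p (fact k :: nat) * (p - 1) \<le> k div p * (p - 1) + k div p"
      using multiplicity_fact_div[OF assms, of k] by (simp add: add_mult_distrib)
    also have "\<dots> = k div p * p" using p by (cases p) simp_all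
    also have "\<dots> \<le> k" by simp
    finally show ?thesis .
  qed simp
qed

lemma fact_dvd_prod_add: "(fact k :: nat) dvd (\<Prod>j=1..k. j + c)"
proof -
  have "fact (k + c) = (\<Prod>j=1..k. j + c) * (fact c :: nat)"
    by (induction k) (simp_all add: prod.nat_ivl_Suc' algebra_simps)
  moreover have "fact (k + c) = ((k + c) choose k) * fact k * (fact c :: nat)"
    using binomial_fact_lemma[of k "k + c"] by (simp add: ac_simps)
  ultimately have "(\<Prod>j=1..k. j + c) = ((k + c) choose k) * fact k" by simp
  then show ?thesis by simp
qed

text \<open>Modulo any divisor of \<open>k!\<close> prime to \<open>d\<close>, the progression is a unit multiple of \<open>k\<close> consecutive integers.\<close>
lemma coprime_part_fact_dvd_prod:
  fixes B d a k :: nat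
  assumes "B dvd fact k" "coprime d B"
  shows "B dvd (\<Prod>j=1..k. d * j + a)"
proof -
  obtain d' where d': "[d * d' = 1] (mod B)" using cong_solve_coprime_nat[OF assms(2)] by auto
  have "[(\<Prod>j=1..k. d' * (d * j + a)) = (\<Prod>j=1..k. j + d' * a)] (mod B)"
  proof (rule cong_prod)
    fix j
    have "[d * d' * j + d' * a = 1 * j + d' * a] (mod B)"
      using d' by (intro cong_add cong_mult cong_refl)
    then show "[d' * (d * j + a) = j + d' * a] (mod B)" by (simp add: algebra_simps)
  qed
  moreover have "B dvd (\<Prod>j=1..k. j + d' * a)" using assms(1) fact_dvd_prod_add dvd_trans by blast
  ultimately have "B dvd (\<Prod>j=1..k. d' * (d * j + a))" using cong_dvd_iff by blast
  then have "B dvd d' ^ k * (\<Prod>j=1..k. d * j + a)" by (simp add: prod.distrib)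
  moreover have "coprime B (d' ^ k)"
  proof -
    have "coprime (d * d') B" using cong_imp_coprime[OF cong_sym[OF d']] by simp
    then show ?thesis by (simp add: coprime_commute)
  qed
  ultimately show ?thesis using coprime_dvd_mult_right_iff by blast
qed

text \<open>Since \<open>p\<close> divides \<open>k!\<close> to a power at most
  \<open>k / (p - 1)\<close>, the part of \<open>k!\<close> composed of primes dividing
  \<open>d\<close> has logarithm at most \<open>k\<close> times this sum.\<close>

definition log_prime_sum :: "nat \<Rightarrow> real" where
  "log_prime_sum d = (\<Sum>p\<in>prime_factors d. ln (real p) / (real p - 1))"

text \<open>Chebyshev's device: \<open>k!\<close> accounts, up to the primes dividing \<open>d\<close>, for the contribution
  of the primes at most \<open>k\<close> to the product of the progression.\<close>
lemma sum_ln_large_prime_divisors_le: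
  fixes a d k :: nat
  assumes "coprime a d" "0 < a" "a \<le> d"
  shows "(\<Sum>p | prime p \<and> k < p \<and> (\<exists>j\<in>{1..k}. p dvd d * j + a). ln (real p))
           \<le> real k * (ln d + log_prime_sum d) + ln (k + 1)"
proof -
  define V where "V = {p. prime p \<and> k < p \<and> (\<exists>j\<in>{1..k}. p dvd d * j + a)}"
  define F :: nat where "F = fact k"
  \<comment> \<open>\<open>A\<close> is the part of \<open>k!\<close> made of the primes dividing
    \<open>d\<close>, so its cofactor \<open>B\<close> is prime to \<open>d\<close> and must divide
    the product \<open>N\<close>.\<close>
  define A where "A = (\<Prod>p\<in>prime_factors d. p ^ multiplicity p F)"
  define N where "N = (\<Prod>j=1..k. d * j + a)"
  have F0: "F > 0" by (simp add: F_def)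
  have d0: "d > 0" using assms by simp
  have N0: "N > 0" using assms by (simp add: N_def)
  have multA: "multiplicity p A = (if p \<in> prime_factors d then multiplicity p F else 0)" if "prime p" for p
    unfolding A_def using that by (intro multiplicity_prod_prime_powers) auto
  have A0: "A > 0" unfolding A_def by (intro prod_pos) (auto intro: prime_gt_0_nat)
  have "A dvd F"
    using F0 A0 multA by (intro multiplicity_le_imp_dvd) auto
  then obtain B where B: "F = A * B" by (elim dvdE)
  have B0: "B > 0" using F0 B by (cases B) auto
  have "coprime d B"
  proof (rule ccontr)
    assume "\<not> coprime d B"
    then have "gcd d B \<noteq> 1" using coprime_iff_gcd_eq_1 by blast
    then obtain q where q: "prime q" "q dvd d" "q dvd B" using prime_factor_nat[of "gcd d B"] by auto
    have "multiplicity q F = multiplicity q A + multiplicity q B"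
      using q A0 B0 by (simp add: B prime_elem_multiplicity_mult_distrib)
    moreover have "multiplicity q A = multiplicity q F"
      using multA q d0 by (simp add: prime_factors_dvd)
    moreover have "multiplicity q B > 0"
      using q B0 by (simp add: prime_multiplicity_gt_zero_iff)
    ultimately show False by simp
  qed
  then have BN: "B dvd N" unfolding N_def
    using B by (intro coprime_part_fact_dvd_prod) (simp_all add: F_def[symmetric])
  have VN: "p dvd N" if "p \<in> V" for p
  proof -
    obtain j where "j \<in> {1..k}" "p dvd d * j + a" using \<open>p \<in> V\<close> by (auto simp: V_def)
    then show ?thesis unfolding N_def by (meson dvd_prodI dvd_trans finite_atLeastAtMost)
  qed
  have finV: "finite V"
    using VN N0 by (intro finite_subset[OF _ finite_divisors_nat[OF N0]]) auto
  have "\<Prod>V dvd N" using finV VN by (intro prod_primes_dvd) (auto simp: V_def)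
  \<comment> \<open>The primes in \<open>V\<close> exceed \<open>k\<close>, hence do not divide
    \<open>k!\<close>; so \<open>N\<close> has room for them besides \<open>B\<close>.\<close>
  moreover have "coprime (\<Prod>V) B"
  proof (rule prod_coprime_left)
    fix p assume p: "p \<in> V"
    then have "\<not> p dvd F" unfolding F_def by (simp add: V_def prime_dvd_fact_iff)
    then have "\<not> p dvd B" using B by auto
    then show "coprime p B" using p by (simp add: V_def prime_imp_coprime)
  qed
  ultimately have "\<Prod>V * B dvd N" using BN by (simp add: divides_mult)
  then have "\<Prod>V * B \<le> N" using N0 by (rule dvd_imp_le)
  then have "\<Prod>V * F \<le> N * A" using B by (metis mult.assoc mult.commute mult_le_mono1)
  \<comment> \<open>Here \<open>a \<le> d\<close> enters: the product is then at most
    \<open>d ^ k * (k + 1)!\<close>, which exceeds \<open>d ^ k * k!\<close> only by the factor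
    \<open>k + 1\<close>.\<close>
  also have "N \<le> (\<Prod>j=1..k. d * (j + 1))"
    unfolding N_def using assms by (intro prod_mono) auto
  also have "\<dots> = d ^ k * (k + 1) * F"
  proof -
    have *: "(\<Prod>j=1..k. j + 1) = (k + 1) * fact k"
      by (induction k) (simp_all add: prod.nat_ivl_Suc' algebra_simps)
    show ?thesis unfolding prod.distrib * F_def by (simp add: algebra_simps)
  qed
  finally have "\<Prod>V \<le> d ^ k * (k + 1) * A" using F0 by (simp add: mult.commute mult.left_commute)
  then have le: "real (\<Prod>V) \<le> real (d ^ k * (k + 1) * A)" by (rule of_nat_mono)
  have V0: "real (\<Prod>V) > 0" unfolding of_nat_0_less_iff by (intro prod_pos) (auto simp: V_def intro: prime_gt_0_nat)
  have "(\<Sum>p\<in>V. ln (real p)) = ln (real (\<Prod>V))"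
    unfolding of_nat_prod using finV by (intro ln_prod[symmetric]) (auto simp: V_def intro: prime_gt_0_nat)
  also have "\<dots> \<le> ln (real (d ^ k * (k + 1) * A))"
    using le V0 by (simp only: ln_le_cancel_iff)
  also have "\<dots> = real k * ln d + ln (k + 1) + ln A"
  proof -
    have "real d ^ k > 0" "real (k + 1) > 0" "real A > 0" using d0 A0 by simp_all
    then show ?thesis
      by (simp only: of_nat_mult of_nat_power ln_mult_pos mult_pos_pos ln_realpow)
  qed
  also have "ln A \<le> real k * log_prime_sum d"
  proof -
    have "ln A = (\<Sum>p\<in>prime_factors d. ln (real p ^ multiplicity p F))"
      unfolding A_def of_nat_prod of_nat_power by (intro ln_prod) (auto intro: prime_gt_0_nat)
    also have "\<dots> \<le> (\<Sum>p\<in>prime_factors d. real k * (ln (real p) / (real p - 1)))"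
    proof (rule sum_mono)
      fix p assume "p \<in> prime_factors d"
      then have p: "prime p" by auto
      then have p1: "p > 1" by (rule prime_gt_1_nat)
      have "multiplicity p F * (p - 1) \<le> k" unfolding F_def using p by (rule multiplicity_fact_le)
      then have "real (multiplicity p F) * (real p - 1) \<le> real k"
        using p1 by (metis of_nat_1 of_nat_diff of_nat_le_iff of_nat_mult less_imp_le)
      then have "real (multiplicity p F) \<le> real k / (real p - 1)"
        using p1 by (simp add: field_simps)
      then have "real (multiplicity p F) * ln p \<le> real k / (real p - 1) * ln p"
        using p1 by (intro mult_right_mono) auto
      then show "ln (real p ^ multiplicity p F) \<le> real k * (ln (real p) / (real p - 1))"
        by (simp add: ln_realpow)
    qed
    also have "\<dots> = real k * log_prime_sum d" by (simp add: log_prime_sum_def sum_distrib_left)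
    finally show ?thesis .
  qed
  finally show ?thesis by (simp add: V_def algebra_simps)
qed

section \<open>The sieve\<close>

lemma card_residue_class_le:
  fixes X :: "nat set"
  assumes "X \<subseteq> {1..T}" "p > 0" "\<And>s t. s \<in> X \<Longrightarrow> t \<in> X \<Longrightarrow> [s = t] (mod p)"
  shows "card X \<le> T div p + 1"
proof -
  have "inj_on (\<lambda>t. t div p) X"
  proof (rule inj_onI)
    fix s t assume st: "s \<in> X" "t \<in> X" "s div p = t div p"
    have "s mod p = t mod p" using assms(3)[OF st(1,2)] unfolding unique_euclidean_semiring_class.cong_def .
    then show "s = t" using st(3) by (metis div_mult_mod_eq)
  qed
  moreover have "(\<lambda>t. t div p) ` X \<subseteq> {0..T div p}"
  proof (rule image_subsetI)
    fix t assume "t \<in> X"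
    then have "t \<le> T" using assms(1) by auto
    then show "t div p \<in> {0..T div p}" by (simp add: div_le_mono)
  qed
  ultimately have "card X \<le> card {0..T div p}" by (meson card_inj_on_le finite_atLeastAtMost)
  then show ?thesis by simp
qed

text \<open>As \<open>y\<close> is below \<open>p ^ e\<close>, its exponent of \<open>p\<close> is
  less than \<open>e\<close>, so the congruence determines both divisibility by that power and
  failure at the next.\<close>

lemma multiplicity_cong_prime_power:
  fixes p x y :: nat
  assumes "prime p" "[x = y] (mod p ^ e)" "0 < y" "y < p ^ e"
  shows "multiplicity p x = multiplicity p y"
proof (rule multiplicity_eqI)
  let ?m = "multiplicity p y"
  have p: "\<not> is_unit p" using assms(1) not_prime_unit by blast
  have "p ^ ?m \<le> y" using assms(3) by (intro dvd_imp_le multiplicity_dvd) auto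
  then have "p ^ ?m < p ^ e" using assms(4) by simp
  then have "?m < e" using prime_gt_1_nat[OF assms(1)] by (simp add: power_strict_increasing_iff)
  then have "[x = y] (mod p ^ ?m)" "[x = y] (mod p ^ Suc ?m)"
    using assms(2) by (meson cong_dvd_modulus_nat le_imp_power_dvd less_imp_le Suc_leI)+
  moreover have "\<not> p ^ Suc ?m dvd y"
    using assms(3) p power_dvd_iff_le_multiplicity[of y p "Suc ?m"] by auto
  ultimately show "p ^ ?m dvd x" "\<not> p ^ Suc ?m dvd x"
    using multiplicity_dvd cong_dvd_iff by blast+
qed

text \<open>The least power beyond \<open>n\<close> overshoots by at most a factor \<open>p\<close>;
  this caps what a small prime adds to the modulus.\<close>

lemma exists_prime_power_between:
  fixes p n :: nat
  assumes "1 < p" "0 < n"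
  shows "\<exists>e. n < p ^ e \<and> p ^ e \<le> p * n"
proof -
  define e where "e = (LEAST e. n < p ^ e)"
  have ex: "n < p ^ n" using assms(1) power_gt_expt[of p n] by simp
  then have e: "n < p ^ e" unfolding e_def by (rule LeastI)
  then obtain f where f: "e = Suc f" using assms(2) by (cases e) auto
  then have "\<not> n < p ^ f" unfolding e_def using not_less_Least[of f "\<lambda>e. n < p ^ e"] by simp
  then show ?thesis using e f by (intro exI[of _ e]) simp
qed

text \<open>Primes up to \<open>z\<close> are imposed through high powers. The primes above \<open>z\<close> are imposed only to
  first order, and the multiple \<open>t\<close> of the modulus is then chosen so that their squares divide nothing.\<close>
lemma exists_shifted_progression:
  fixes a d k z b :: nat and I :: "nat set"
  defines "V \<equiv> {p \<in> I. z < p \<and> (\<exists>j\<in>{1..k}. p dvd d * j + a)}"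
  assumes "coprime a d" "0 < a" "0 < d"
    and I: "\<And>p. p \<in> I \<Longrightarrow> prime p \<and> \<not> p dvd d"
    and z: "d * k + a < z * z"
    and few: "card {p. prime p \<and> p \<le> d * k + a} * (k div z + 1) * (k div z + 1) < k"
  shows "\<exists>y. b \<le> y \<and> y < (k + b + 1) * ((z * (d * k + a)) ^ card {p. prime p \<and> p \<le> z} * \<Prod>V) \<and>
           (\<forall>j\<in>{1..k}. \<forall>p\<in>I. p dvd d * j + a \<longrightarrow> multiplicity p (y + j) = multiplicity p (d * j + a))"
proof -
  define n where "n = d * k + a"
  define W where "W = {p \<in> I. p \<le> z}"
  have n0: "n > 0" using assms by (simp add: n_def)
  have z0: "z > 0" using z by (cases z) auto
  have jn: "d * j + a \<le> n" if "j \<in> {1..k}" for j using that by (simp add: n_def)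
  have Vn: "prime p \<and> z < p \<and> p \<le> n" if "p \<in> V" for p
  proof -
    obtain j where j: "j \<in> {1..k}" "p dvd d * j + a" using \<open>p \<in> V\<close> by (auto simp: V_def)
    then have "p \<le> d * j + a" using assms(3) by (intro dvd_imp_le) auto
    then show ?thesis using jn[OF j(1)] \<open>p \<in> V\<close> I by (auto simp: V_def)
  qed
  have finV: "finite V" by (rule finite_subset[of _ "{..n}"]) (use Vn in auto)
  have finW: "finite W" by (simp add: W_def)
  have "\<forall>p\<in>W. \<exists>e. n < p ^ e \<and> p ^ e \<le> p * n"
    using exists_prime_power_between n0 I prime_gt_1_nat by (auto simp: W_def)
  then obtain e where e: "\<And>p. p \<in> W \<Longrightarrow> n < p ^ e p \<and> p ^ e p \<le> p * n" by metis
  \<comment> \<open>Each power exceeds every term of the progression, so a congruence modulo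
    \<open>M1\<close> fixes the exact exponents of all small primes.\<close>
  define M1 where "M1 = (\<Prod>p\<in>W. p ^ e p)"
  define M where "M = M1 * \<Prod>V"
  have IW: "prime p" "\<not> p dvd d" if "p \<in> W" for p using that I by (auto simp: W_def)
  have IV: "prime p" "\<not> p dvd d" if "p \<in> V" for p using that I by (auto simp: V_def)
  have M10: "M1 > 0" unfolding M1_def using IW prime_gt_0_nat by (intro prod_pos) auto
  have V0: "\<Prod>V > 0" using IV prime_gt_0_nat by (intro prod_pos) auto
  have M0: "M > 0" using M10 V0 by (simp add: M_def)
  have VM: "p dvd M" if "p \<in> V" for p
    unfolding M_def using dvd_prodI[OF finV that, of "\<lambda>p. p"] by (rule dvd_mult)
  have "M1 \<le> (z * n) ^ card {p. prime p \<and> p \<le> z}"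
  proof -
    have "M1 \<le> (\<Prod>p\<in>W. z * n)"
      unfolding M1_def
    proof (rule prod_mono)
      fix p assume "p \<in> W"
      then have "p ^ e p \<le> p * n" "p \<le> z" using e by (auto simp: W_def)
      then show "0 \<le> p ^ e p \<and> p ^ e p \<le> z * n" by (meson le0 le_trans mult_le_mono1)
    qed
    also have "\<dots> = (z * n) ^ card W" by simp
    also have "\<dots> \<le> (z * n) ^ card {p. prime p \<and> p \<le> z}"
      using z0 n0 I by (intro power_increasing card_mono) (auto simp: W_def)
    finally show ?thesis .
  qed
  then have Mle: "M \<le> (z * n) ^ card {p. prime p \<and> p \<le> z} * \<Prod>V" by (simp add: M_def)
  have copV: "coprime d (\<Prod>V)"
    using IV by (intro prod_coprime_right) (auto simp: coprime_commute prime_imp_coprime)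
  have "coprime d M1" unfolding M1_def
    using IW by (intro prod_coprime_right) (auto simp: coprime_commute prime_imp_coprime)
  then have "coprime d M" using copV by (simp add: M_def)
  then obtain d' where d': "[d * d' = 1] (mod M)" using cong_solve_coprime_nat by auto
  \<comment> \<open>The solution of \<open>d * y = a\<close> modulo \<open>M\<close>, raised by
    \<open>b * M\<close> so that it is at least \<open>b\<close>.\<close>
  define y0 where "y0 = (d' * a) mod M + b * M"
  have y0: "[d * y0 = a] (mod M)"
  proof -
    have "[d * y0 = d * (d' * a)] (mod M)"
      unfolding y0_def by (intro cong_mult cong_refl) (simp add: unique_euclidean_semiring_class.cong_def)
    also have "d * (d' * a) = d * d' * a" by simp
    also have "[d * d' * a = 1 * a] (mod M)" using d' by (intro cong_mult cong_refl)
    finally show ?thesis by simp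
  qed
  \<comment> \<open>\<open>J p\<close> collects the positions that \<open>p\<close> divides, and
    \<open>bad p j\<close> the shifts \<open>t\<close> for which the square of \<open>p\<close>
    divides the term at position \<open>j\<close>. A shift outside all of these sets is
    sought.\<close>
  define J where "J p = {j \<in> {1..k}. p dvd d * j + a}" for p
  define bad where "bad p j = {t \<in> {1..k}. p ^ 2 dvd y0 + t * M + j}" for p j
  have cong: "[d * (y0 + t * M + j) = d * j + a] (mod M)" for t j
  proof -
    have "[d * y0 + (d * t * M + d * j) = a + (0 + d * j)] (mod M)"
      using y0 by (intro cong_add cong_refl) (auto simp: cong_0_iff)
    then show ?thesis by (simp add: algebra_simps)
  qed
  have cardJ: "card (J p) \<le> k div z + 1" if "p \<in> V" for p
  proof -
    have p: "prime p" "\<not> p dvd d" "z < p" using that Vn IV by auto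
    then have "coprime d p" by (metis coprime_commute prime_imp_coprime)
    moreover have "[d * s = d * t] (mod p)" if "s \<in> J p" "t \<in> J p" for s t
    proof -
      have "[d * s + a = d * t + a] (mod p)"
        using that by (auto simp: J_def unique_euclidean_semiring_class.cong_def dvd_eq_mod_eq_0)
      then show ?thesis by (simp add: cong_add_rcancel_nat)
    qed
    ultimately have "card (J p) \<le> k div p + 1"
      using p prime_gt_0_nat by (intro card_residue_class_le) (auto simp: J_def cong_mult_lcancel_nat)
    also have "k div p \<le> k div z" using p z0 by (intro div_le_mono2) auto
    finally show ?thesis by simp
  qed
  \<comment> \<open>\<open>p\<close> divides \<open>M\<close> exactly once. If the shifts
    \<open>s\<close> and \<open>t\<close> are both bad at \<open>j\<close>, then \<open>p^2\<close>
    divides \<open>(s - t) * M\<close>, so \<open>s\<close> and \<open>t\<close> agree modulo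
    \<open>p\<close>.\<close>
  have card_bad: "card (bad p j) \<le> k div z + 1" if "p \<in> V" for p j
  proof -
    have p: "prime p" "z < p" using that Vn by auto
    have pM: "p dvd M" using that by (rule VM)
    have "\<not> p\<^sup>2 dvd M"
    proof
      assume "p\<^sup>2 dvd M"
      moreover have "M = p * (M1 * \<Prod>(V - {p}))"
        using that finV by (simp add: M_def prod.remove)
      ultimately have "p dvd M1 * \<Prod>(V - {p})"
        using p prime_gt_0_nat by (simp add: power2_eq_square)
      then consider "p dvd M1" | "p dvd \<Prod>(V - {p})" using p prime_dvd_mult_iff by blast
      then show False
      proof cases
        case 1
        then obtain q where "q \<in> W" "p dvd q ^ e q"
          using p(1) prime_dvd_prod_iff[OF finW, of p "\<lambda>q. q ^ e q"] by (auto simp: M1_def)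
        then have "p = q" using IW p prime_dvd_power primes_dvd_imp_eq by blast
        then show False using \<open>q \<in> W\<close> p by (simp add: W_def)
      next
        case 2
        then obtain q where "q \<in> V - {p}" "p dvd q"
          using p(1) finV prime_dvd_prod_iff[of "V - {p}" p "\<lambda>x. x"] by auto
        then show False using IV p primes_dvd_imp_eq by blast
      qed
    qed
    have cong_p: "[s = t] (mod p)" if st: "s \<in> bad p j" "t \<in> bad p j" for s t
    proof -
      have "[y0 + s * M + j = y0 + t * M + j] (mod p\<^sup>2)"
        using st by (auto simp: bad_def unique_euclidean_semiring_class.cong_def dvd_eq_mod_eq_0)
      then have "[s * M = t * M] (mod p\<^sup>2)"
        by (simp add: cong_add_rcancel_nat cong_add_lcancel_nat)
      moreover obtain M' where M': "M = p * M'" using pM by (elim dvdE)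
      ultimately have "[p * (s * M') = p * (t * M')] (mod p * p)"
        by (simp add: power2_eq_square ac_simps)
      then have "[s * M' = t * M'] (mod p)"
        using p(1) prime_gt_0_nat by (simp add: unique_euclidean_semiring_class.cong_def mod_mult_mult1)
      moreover have "\<not> p dvd M'" using \<open>\<not> p\<^sup>2 dvd M\<close> M' by (auto simp: power2_eq_square)
      then have "coprime M' p" using p(1) by (metis coprime_commute prime_imp_coprime)
      ultimately show ?thesis using cong_mult_rcancel_nat by blast
    qed
    have "card (bad p j) \<le> k div p + 1"
      using p cong_p prime_gt_0_nat by (intro card_residue_class_le) (auto simp: bad_def)
    also have "k div p \<le> k div z" using p z0 by (intro div_le_mono2) auto
    finally show ?thesis by simp
  qed
  have "card (\<Union>p\<in>V. \<Union>j\<in>J p. bad p j) \<le> (\<Sum>p\<in>V. card (\<Union>j\<in>J p. bad p j))"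
    using finV by (rule card_UN_le)
  also have "\<dots> \<le> (\<Sum>p\<in>V. (k div z + 1) * (k div z + 1))"
  proof (rule sum_mono)
    fix p assume p: "p \<in> V"
    have "card (\<Union>j\<in>J p. bad p j) \<le> (\<Sum>j\<in>J p. card (bad p j))"
      by (rule card_UN_le) (simp add: J_def)
    also have "\<dots> \<le> (\<Sum>j\<in>J p. k div z + 1)" using card_bad[OF p] by (intro sum_mono) auto
    also have "\<dots> \<le> (k div z + 1) * (k div z + 1)" 
      using mult_le_mono1[OF cardJ[OF p], of "k div z + 1"] by (simp only: sum_constant of_nat_id)
    finally show "card (\<Union>j\<in>J p. bad p j) \<le> (k div z + 1) * (k div z + 1)" .
  qed
  also have "\<dots> = card V * (k div z + 1) * (k div z + 1)"
    by (simp only: sum_constant of_nat_id mult.assoc)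
  also have "\<dots> \<le> card {p. prime p \<and> p \<le> d * k + a} * (k div z + 1) * (k div z + 1)"
    using Vn by (intro mult_le_mono1 card_mono) (auto simp: n_def)
  also have "\<dots> < k" by (rule few)
  finally have "card (\<Union>p\<in>V. \<Union>j\<in>J p. bad p j) < card {1..k}" by simp
  then obtain t where t: "t \<in> {1..k}" "t \<notin> (\<Union>p\<in>V. \<Union>j\<in>J p. bad p j)"
  proof -
    assume lt: "card (\<Union>p\<in>V. \<Union>j\<in>J p. bad p j) < card {1..k}"
    have fin: "finite (\<Union>p\<in>V. \<Union>j\<in>J p. bad p j)" using finV by (simp add: J_def bad_def)
    have "\<exists>t. t \<in> {1..k} \<and> t \<notin> (\<Union>p\<in>V. \<Union>j\<in>J p. bad p j)"
    proof (rule ccontr)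
      assume "\<not> ?thesis"
      then have "{1..k} \<subseteq> (\<Union>p\<in>V. \<Union>j\<in>J p. bad p j)" by (intro subsetI) metis
      then show False using card_mono[OF fin] lt by (meson leD)
    qed
    then show ?thesis using that by blast
  qed
  define y where "y = y0 + t * M"
  have "b \<le> b * M" using M0 by simp
  then have "b \<le> y" unfolding y_def y0_def by linarith
  moreover have "y < (k + b + 1) * ((z * n) ^ card {p. prime p \<and> p \<le> z} * \<Prod>V)"
  proof -
    have "y < M + b * M + t * M" using M0 by (simp add: y_def y0_def)
    also have "\<dots> \<le> M + b * M + k * M" using t by simp
    also have "\<dots> = (k + b + 1) * M" by (simp add: algebra_simps)
    also have "\<dots> \<le> (k + b + 1) * ((z * n) ^ card {p. prime p \<and> p \<le> z} * \<Prod>V)"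
      using Mle by (intro mult_le_mono2)
    finally show ?thesis .
  qed
  moreover have "multiplicity p (y + j) = multiplicity p (d * j + a)"
    if j: "j \<in> {1..k}" and p: "p \<in> I" "p dvd d * j + a" for j p
  proof (cases "p \<le> z")
    case True
    then have W: "p \<in> W" using p by (simp add: W_def)
    have "p ^ e p dvd M" unfolding M_def M1_def using W finW by (intro dvd_mult2 dvd_prodI)
    then have "[d * (y + j) = d * j + a] (mod p ^ e p)"
      using cong[of t j] unfolding y_def by (meson cong_dvd_modulus_nat)
    moreover have "d * j + a < p ^ e p" using e[OF W] jn[OF j] by linarith
    ultimately have "multiplicity p (d * (y + j)) = multiplicity p (d * j + a)"
      using IW[OF W] assms(3) by (intro multiplicity_cong_prime_power) auto
    moreover have "multiplicity p (d * (y + j)) = multiplicity p d + multiplicity p (y + j)"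
      using IW[OF W] assms(4) j by (intro prime_elem_multiplicity_mult_distrib) auto
    moreover have "multiplicity p d = 0" using IW[OF W] by (simp add: not_dvd_imp_multiplicity_0)
    ultimately show ?thesis by simp
  next
    case False
    then have V: "p \<in> V" using p j by (auto simp: V_def)
    have pr: "prime p" using IV V by blast
    have one: "multiplicity p x = 1" if "p dvd x" "\<not> p\<^sup>2 dvd x" for x
      using that by (intro multiplicity_eqI) (auto simp: power2_eq_square)
    \<comment> \<open>A prime above \<open>z\<close> has a square beyond \<open>z * z\<close>,
      larger than every term, so its exponent in the progression is exactly 1.\<close>
    have "\<not> p\<^sup>2 dvd d * j + a"
    proof
      assume "p\<^sup>2 dvd d * j + a"
      then have "p\<^sup>2 \<le> d * j + a" using assms(3) by (intro dvd_imp_le) auto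
      moreover have "z * z \<le> p\<^sup>2" using False unfolding power2_eq_square by (intro mult_le_mono) auto
      ultimately show False using z jn[OF j] unfolding n_def by linarith
    qed
    then have "multiplicity p (d * j + a) = 1" using one p by blast
    moreover have "multiplicity p (y + j) = 1"
    proof (rule one)
      have "p dvd M" using V by (rule VM)
      then have "[d * (y + j) = d * j + a] (mod p)"
        using cong[of t j] unfolding y_def by (meson cong_dvd_modulus_nat)
      then have "p dvd d * (y + j)" using p(2) cong_dvd_iff by blast
      then show "p dvd y + j" using IV V prime_dvd_mult_iff by blast
      show "\<not> p\<^sup>2 dvd y + j"
        using t V j p by (auto simp: J_def bad_def y_def)
    qed
    ultimately show ?thesis by simp
  qed
  ultimately show ?thesis by (auto simp: n_def)
qed

text \<open>Take \<open>z\<close> to be the integer part of \<open>\<epsilon> * k\<close>. The large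
  primes cost the main term, the high powers of small primes at most
  \<open>15 * \<epsilon> * k\<close>, and the logarithms of \<open>k + b + 1\<close> and
  \<open>k + 1\<close> together at most \<open>\<epsilon> * k\<close>; hence the division by 16 in
  the choice of \<open>\<epsilon>\<close>.\<close>

lemma eventually_shifted_progression:
  fixes a d b :: nat and I :: "nat set" and c C :: real
  assumes "coprime a d" "0 < a" "a \<le> d" "0 < b"
    and I: "\<And>p. p \<in> I \<Longrightarrow> prime p \<and> \<not> p dvd d"
    and small: "eventually (\<lambda>k. (\<Sum>p | p \<in> I \<and> p \<le> k. ln (real p)) \<le> c * k) sequentially"
    and C: "ln d + log_prime_sum d + c < C"
  shows "eventually (\<lambda>k. \<exists>y. b \<le> y \<and> ln (real y) \<le> C * k \<and>
           (\<forall>j\<in>{1..k}. \<forall>p\<in>I. p dvd d * j + a \<longrightarrow> multiplicity p (y + j) = multiplicity p (d * j + a)))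
           sequentially"
proof -
  define \<epsilon> where "\<epsilon> = (C - (ln d + log_prime_sum d + c)) / 16"
  have \<epsilon>: "\<epsilon> > 0" using C by (simp add: \<epsilon>_def)
  \<comment> \<open>Since \<open>z\<close> is at least \<open>\<epsilon> * k / 2\<close>, this
    bounds \<open>k div z + 1\<close>, so every large prime spoils at most \<open>K ^ 2\<close>
    shifts.\<close>
  define K where "K = 2 / \<epsilon> + 1"
  have d0: "real d > 0" and a0: "real a > 0" and b0: "real b > 0" using assms by auto
  have e1: "eventually (\<lambda>k::nat. real d * real k + real a < (\<epsilon> * real k - 1) ^ 2) sequentially"
    using \<epsilon> d0 a0 by real_asymp
  have e2: "eventually (\<lambda>k::nat. \<epsilon> * real k \<ge> 4) sequentially"
    using \<epsilon> by real_asymp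
  \<comment> \<open>At most \<open>10 * d * k / ln k\<close> primes are involved, so this makes the
    number of spoiled shifts less than \<open>k\<close>.\<close>
  have e3: "eventually (\<lambda>k::nat. ln (real k) > 10 * d * K ^ 2) sequentially"
    by real_asymp
  have e4: "eventually (\<lambda>k::nat. ln (real k + real b + 1) + ln (real k + 1) \<le> \<epsilon> * real k) sequentially"
    using \<epsilon> b0 by real_asymp
  show ?thesis
    using small e1 e2 e3 e4 eventually_ge_at_top[of "1 :: nat"]
  proof eventually_elim
    case (elim k)
    define z where "z = nat \<lfloor>\<epsilon> * real k\<rfloor>"
    define n where "n = d * k + a"
    define V where "V = {p \<in> I. z < p \<and> (\<exists>j\<in>{1..k}. p dvd d * j + a)}"
    have z: "real z \<le> \<epsilon> * k" "\<epsilon> * k - 1 < real z" "\<epsilon> * k / 2 \<le> real z" "real z \<ge> 3"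
      using elim(3) by (auto simp: z_def) linarith+
    have n1: "n \<ge> 1" "n \<ge> k" using assms elim(6) by (auto simp: n_def intro: le_trans[OF _ le_add1])
    have zz: "real n < real z * real z"
    proof -
      have "real n < (\<epsilon> * real k - 1) ^ 2" using elim(2) by (simp add: n_def)
      also have "\<dots> \<le> real z ^ 2" using z elim(3) by (intro power_mono) auto
      finally show ?thesis by (simp add: power2_eq_square)
    qed
    then have "d * k + a < z * z" unfolding n_def of_nat_mult[symmetric] of_nat_less_iff .
    moreover have "card {p. prime p \<and> p \<le> d * k + a} * (k div z + 1) * (k div z + 1) < k"
    proof -
      let ?\<pi> = "real (card {p. prime p \<and> p \<le> d * k + a})"
      have lnk: "ln (real k) \<ge> 0" using elim(6) by simp
      have K0: "K \<ge> 0" using \<epsilon> by (simp add: K_def)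
      have "?\<pi> * ln (real k) \<le> ?\<pi> * ln (real n)"
        using n1 elim(6) by (intro mult_left_mono) auto
      also have "\<dots> \<le> 5 * real n" using card_primes_mult_ln_le[OF n1(1)] by (simp add: n_def)
      also have "\<dots> \<le> 10 * d * k"
      proof -
        have "d * 1 \<le> d * k" by (rule mult_le_mono2[OF elim(6)])
        then have "n \<le> 2 * (d * k)" using assms(3) unfolding n_def by linarith
        then have "real n \<le> real (2 * (d * k))" by (rule of_nat_mono)
        then show ?thesis by simp
      qed
      finally have pi: "?\<pi> * ln (real k) \<le> 10 * d * k" .
      have "real (k div z) \<le> real k / real z" by (rule of_nat_div_le_of_nat)
      moreover have "real k / real z \<le> 2 / \<epsilon>" using z \<epsilon> by (simp add: field_simps)
      ultimately have kz: "real (k div z + 1) \<le> K" by (simp add: K_def)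
      have "?\<pi> * K ^ 2 * ln (real k) \<le> 10 * d * k * K ^ 2"
        using mult_right_mono[OF pi, of "K ^ 2"] by (simp add: ac_simps)
      also have "\<dots> < k * ln (real k)" using elim(4,6) by (simp add: ac_simps)
      finally have "?\<pi> * K ^ 2 < k" using lnk by (simp add: mult_less_cancel_right)
      moreover have "?\<pi> * real (k div z + 1) * real (k div z + 1) \<le> ?\<pi> * K ^ 2"
        unfolding power2_eq_square mult.assoc using kz K0 by (intro mult_left_mono mult_mono) auto
      ultimately have "real (card {p. prime p \<and> p \<le> d * k + a} * (k div z + 1) * (k div z + 1)) < real k"
        unfolding of_nat_mult by linarith
      then show ?thesis by (simp only: of_nat_less_iff)
    qed
    ultimately obtain y where y: "b \<le> y"
      "y < (k + b + 1) * ((z * n) ^ card {p. prime p \<and> p \<le> z} * \<Prod>V)"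
      "\<forall>j\<in>{1..k}. \<forall>p\<in>I. p dvd d * j + a \<longrightarrow> multiplicity p (y + j) = multiplicity p (d * j + a)"
      using exists_shifted_progression[of a d I k z b] assms(1-3) I unfolding V_def n_def by auto
    have Vp: "prime p" if "p \<in> V" for p using that I by (auto simp: V_def)
    have finV: "finite V"
    proof (rule finite_subset)
      show "V \<subseteq> {..n}"
      proof
        fix p assume "p \<in> V"
        then obtain j where j: "j \<in> {1..k}" "p dvd d * j + a" by (auto simp: V_def)
        then have "p \<le> d * j + a" using assms(2) by (intro dvd_imp_le) auto
        also have "\<dots> \<le> n" using j by (simp add: n_def)
        finally show "p \<in> {..n}" by simp
      qed
    qed simp
    have "ln (real (\<Prod>V)) = (\<Sum>p\<in>V. ln (real p))"
      unfolding of_nat_prod using finV Vp prime_gt_0_nat by (intro ln_prod) auto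
    \<comment> \<open>The primes of \<open>V\<close> up to \<open>k\<close> are charged to the
      assumed bound on \<open>I\<close>, those above \<open>k\<close> to the bound on large prime
      divisors of the progression.\<close>
    also have "\<dots> \<le> (\<Sum>p\<in>{p \<in> I. p \<le> k} \<union> {p. prime p \<and> k < p \<and> (\<exists>j\<in>{1..k}. p dvd d * j + a)}. ln (real p))"
    proof (rule sum_mono2)
      have "{p. prime p \<and> k < p \<and> (\<exists>j\<in>{1..k}. p dvd d * j + a)} \<subseteq> {..n}"
      proof
        fix p assume "p \<in> {p. prime p \<and> k < p \<and> (\<exists>j\<in>{1..k}. p dvd d * j + a)}"
        then obtain j where j: "j \<in> {1..k}" "p dvd d * j + a" by auto
        then have "p \<le> d * j + a" using assms(2) by (intro dvd_imp_le) auto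
        also have "\<dots> \<le> n" using j by (simp add: n_def)
        finally show "p \<in> {..n}" by simp
      qed
      then show "finite ({p \<in> I. p \<le> k} \<union> {p. prime p \<and> k < p \<and> (\<exists>j\<in>{1..k}. p dvd d * j + a)})"
        by (simp add: finite_subset)
      show "V \<subseteq> {p \<in> I. p \<le> k} \<union> {p. prime p \<and> k < p \<and> (\<exists>j\<in>{1..k}. p dvd d * j + a)}"
        using Vp by (auto simp: V_def)
      show "0 \<le> ln (real p)" if "p \<in> {p \<in> I. p \<le> k} \<union> {p. prime p \<and> k < p \<and> (\<exists>j\<in>{1..k}. p dvd d * j + a)} - V" for p
      proof -
        have "prime p" using that I by auto
        then show ?thesis using prime_ge_1_nat by simp
      qed
    qed
    also have "\<dots> \<le> (\<Sum>p | p \<in> I \<and> p \<le> k. ln (real p))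
        + (\<Sum>p | prime p \<and> k < p \<and> (\<exists>j\<in>{1..k}. p dvd d * j + a). ln (real p))"
    proof (cases "finite {p. prime p \<and> k < p \<and> (\<exists>j\<in>{1..k}. p dvd d * j + a)}")
      case True
      then show ?thesis by (subst sum.union_disjoint) auto
    next
      case False
      then show ?thesis
        using I prime_ge_1_nat by (auto intro!: sum_nonneg)
    qed
    also have "\<dots> \<le> c * k + (real k * (ln d + log_prime_sum d) + ln (k + 1))"
      using elim(1) sum_ln_large_prime_divisors_le[OF assms(1-3), of k] by (intro add_mono)
    finally have lnV: "ln (real (\<Prod>V)) \<le> k * (ln d + log_prime_sum d + c) + ln (real k + 1)"
      by (simp add: algebra_simps)
    have V0: "real (\<Prod>V) > 0" using Vp prime_gt_0_nat unfolding of_nat_0_less_iff by (intro prod_pos) auto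
    have zn: "real (z * n) > 0" using z n1 by simp
    define \<pi> where "\<pi> = card {p. prime p \<and> p \<le> z}"
    have "ln (real y) \<le> ln (real (k + b + 1) * (real (z * n) ^ \<pi> * real (\<Prod>V)))"
    proof (rule ln_mono)
      show "0 < real y" using y(1) assms(4) by simp
      have "real y \<le> real ((k + b + 1) * ((z * n) ^ \<pi> * \<Prod>V))"
        using y(2) unfolding \<pi>_def of_nat_le_iff by simp
      then show "real y \<le> real (k + b + 1) * (real (z * n) ^ \<pi> * real (\<Prod>V))"
        by (simp only: of_nat_mult of_nat_power)
    qed
    also have "\<dots> = ln (real (k + b + 1)) + (\<pi> * ln (real (z * n)) + ln (real (\<Prod>V)))"
    proof -
      have "real (k + b + 1) > 0" by simp
      then show ?thesis using zn V0
        by (simp only: ln_mult_pos mult_pos_pos zero_less_power ln_realpow)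
    qed
    \<comment> \<open>From \<open>n < z * z\<close> one has
      \<open>ln (z * n) \<le> 3 * ln z\<close>, and the Chebyshev bound
      \<open>\<pi> * ln z \<le> 5 * z\<close> yields the 15.\<close>
    also have "\<pi> * ln (real (z * n)) \<le> 15 * (\<epsilon> * k)"
    proof -
      have "real (z * n) \<le> real z ^ 3" using zz z by (simp add: power3_eq_cube mult.assoc)
      then have "ln (real (z * n)) \<le> ln (real z ^ 3)" using zn by (intro ln_mono) auto
      then have "ln (real (z * n)) \<le> 3 * ln (real z)" by (simp only: ln_realpow of_nat_numeral)
      then have "\<pi> * ln (real (z * n)) \<le> \<pi> * (3 * ln (real z))" by (intro mult_left_mono) auto
      also have "\<dots> \<le> 3 * (5 * real z)"
        using card_primes_mult_ln_le[of z] z unfolding \<pi>_def by (simp add: mult.commute)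
      also have "\<dots> \<le> 15 * (\<epsilon> * k)" using z by simp
      finally show ?thesis .
    qed
    finally have "ln (real y) \<le> ln (real (k + b + 1)) + 15 * (\<epsilon> * k) + k * (ln d + log_prime_sum d + c) + ln (real k + 1)"
      using lnV by linarith
    also have "\<dots> \<le> 16 * \<epsilon> * k + k * (ln d + log_prime_sum d + c)"
      using elim(5) by (simp add: algebra_simps)
    also have "\<dots> = C * k" by (simp add: \<epsilon>_def field_simps)
    finally show ?case using y by blast
  qed
qed

section \<open>From intervals without represented integers to the upper limit\<close>

lemma limsup_ge_of_frequently:
  fixes f :: "nat \<Rightarrow> ereal"
  assumes "\<And>m. \<exists>n\<ge>m. f n \<ge> c"
  shows "limsup f \<ge> c"
  unfolding limsup_INF_SUP
proof (rule INF_greatest)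
  fix m
  obtain n where "n \<ge> m" "f n \<ge> c" using assms by blast
  then show "c \<le> (SUP n\<in>{m..}. f n)" by (intro SUP_upper2[of n]) auto
qed

text \<open>Let \<open>s n\<close> be the last element not exceeding \<open>y\<close>. Its successor
  lies beyond \<open>y + k\<close>, so the gap exceeds \<open>k\<close>, while
  \<open>ln (s n) \<le> ln y \<le> C * k\<close>. The bound \<open>y \<ge> s 0\<close> ensures that
  such an \<open>n\<close> exists.\<close>

lemma limsup_gap_ge:
  fixes s :: "nat \<Rightarrow> nat" and C :: real
  assumes "strict_mono s" "C > 0"
    and gap: "eventually (\<lambda>k. \<exists>y\<ge>s 0. ln (real y) \<le> C * k \<and> (\<forall>j\<in>{1..k}. y + j \<notin> range s)) sequentially"
  shows "limsup (\<lambda>n. ereal ((real (s (Suc n)) - real (s n)) / ln (real (s n)))) \<ge> ereal (1 / C)"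
proof (rule limsup_ge_of_frequently)
  fix m
  have mono: "s i \<le> s j \<longleftrightarrow> i \<le> j" for i j using assms(1) by (rule strict_mono_less_eq)
  obtain k0 where k0: "\<And>k. k \<ge> k0 \<Longrightarrow> \<exists>y\<ge>s 0. ln (real y) \<le> C * k \<and> (\<forall>j\<in>{1..k}. y + j \<notin> range s)"
    using gap unfolding eventually_sequentially by blast
  \<comment> \<open>Adding \<open>s (m + 3)\<close> pushes the successor beyond that element, so
    \<open>n\<close> is at least \<open>m\<close>, and at least 2, which keeps
    \<open>ln (s n)\<close> positive.\<close>
  define k where "k = k0 + s (m + 3)"
  obtain y where y: "y \<ge> s 0" "ln (real y) \<le> C * k" "\<forall>j\<in>{1..k}. y + j \<notin> range s"
    using k0[of k] by (auto simp: k_def)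
  define n where "n = Max {n. s n \<le> y}"
  have "{n. s n \<le> y} \<subseteq> {..y}" using strict_mono_imp_increasing[OF assms(1)] by (auto intro: le_trans)
  then have fin: "finite {n. s n \<le> y}" using finite_subset by blast
  have ne: "{n. s n \<le> y} \<noteq> {}" using y(1) by blast
  have n: "s n \<le> y" using Max_in[OF fin ne] by (simp add: n_def)
  have "\<not> s (Suc n) \<le> y" using Max_ge[OF fin, of "Suc n"] by (auto simp: n_def)
  then have "s (Suc n) > y" by simp
  have big: "s (Suc n) > y + k"
  proof (rule ccontr)
    assume "\<not> ?thesis"
    then have "s (Suc n) - y \<in> {1..k}" "y + (s (Suc n) - y) = s (Suc n)"
      using \<open>s (Suc n) > y\<close> by auto
    then show False using y(3) by (metis rangeI)
  qed
  then have "s (m + 3) < s (Suc n)" by (simp add: k_def)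
  then have "m + 3 < Suc n" using assms(1) strict_mono_less by blast
  then have nm: "n \<ge> m" "n \<ge> 2" by simp_all
  have "n \<le> s n" using strict_mono_imp_increasing[OF assms(1)] .
  then have sn: "real (s n) \<ge> 2" using nm by simp
  then have pos: "ln (real (s n)) > 0" by simp
  have "ln (real (s n)) \<le> ln (real y)" using n sn by (intro ln_mono) auto
  also have "\<dots> \<le> C * k" by (rule y(2))
  also have "\<dots> \<le> C * (real (s (Suc n)) - real (s n))"
    using big n assms(2) by (intro mult_left_mono) auto
  finally have "1 / C \<le> (real (s (Suc n)) - real (s n)) / ln (real (s n))"
    using pos assms(2) by (simp add: field_simps)
  then show "\<exists>n\<ge>m. ereal (1 / C) \<le> ereal ((real (s (Suc n)) - real (s n)) / ln (real (s n)))"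
    using nm by auto
qed

section \<open>The sum over the primes dividing the modulus\<close>

text \<open>Since \<open>(1 + q / n) ^ n \<le> exp q\<close>, a numerical bound on a logarithm
  reduces to an exact comparison of rationals. The exponent \<open>n\<close> tunes the precision;
  the companion lemma for lower bounds uses \<open>1 - q / n\<close> in the same way.\<close>

lemma ln_le_of_le_power:
  fixes x q :: real
  assumes "0 < x" "0 \<le> q" "0 < n" "x \<le> (1 + q / real n) ^ n"
  shows "ln x \<le> q"
proof -
  have "x \<le> exp (q / real n) ^ n"
    using assms(4) power_mono[OF exp_ge_add_one_self[of "q / real n"], of n] assms(2) by simp
  also have "\<dots> = exp q" using assms(3) by (simp flip: exp_of_nat_mult)
  finally have "ln x \<le> ln (exp q)" using assms(1) by (intro ln_mono) auto
  then show ?thesis by simp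
qed

lemma ln_ge_of_ge_power:
  fixes x q :: real
  assumes "0 < x" "q < real n" "0 < n" "1 \<le> x * (1 - q / real n) ^ n"
  shows "q \<le> ln x"
proof -
  have "(1 - q / real n) ^ n \<le> exp (- q / real n) ^ n"
    using exp_ge_add_one_self[of "- q / real n"] assms(2,3) by (intro power_mono) auto
  also have "\<dots> = exp (- q)" using assms(3) by (simp flip: exp_of_nat_mult)
  finally have "1 \<le> x * exp (- q)"
    using assms(1,4) mult_left_mono[of "(1 - q / real n) ^ n" "exp (- q)" x] by linarith
  then have "exp q \<le> x" by (simp add: exp_minus field_simps)
  then show ?thesis using assms(1) by (simp add: ln_ge_iff)
qed

lemma sum_ln_prime_factors_le:
  fixes d :: nat
  assumes "d > 0"
  shows "(\<Sum>p\<in>prime_factors d. ln (real p)) \<le> ln (real d)"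
proof -
  have p0: "0 < p" if "p \<in> prime_factors d" for p
  proof -
    have "prime p" using that by (rule in_prime_factors_imp_prime)
    then show ?thesis by (rule prime_gt_0_nat)
  qed
  then have pos: "\<Prod>(prime_factors d) > 0" by (rule prod_pos)
  have "\<Prod>(prime_factors d) dvd d" by (intro prod_primes_dvd) auto
  then have le: "\<Prod>(prime_factors d) \<le> d" using assms by (rule dvd_imp_le)
  have "(\<Sum>p\<in>prime_factors d. ln (real p)) = ln (real (\<Prod>(prime_factors d)))"
    unfolding of_nat_prod using p0 by (intro ln_prod[symmetric]) auto
  also have "\<dots> \<le> ln (real d)" using pos le by (intro ln_mono) (simp_all only: of_nat_0_less_iff of_nat_le_iff)
  finally show ?thesis .
qed

text \<open>A prime \<open>p > y\<close> contributes at most \<open>ln p / y\<close>, so all of these together at most \<open>ln d / y\<close>.\<close>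
lemma log_prime_sum_le_truncated:
  assumes "d > 0" "y > 0"
  shows "log_prime_sum d \<le> (\<Sum>p | prime p \<and> p \<le> y. ln (real p) * (1 / (real p - 1) - 1 / real y)) + ln (real d) / real y"
proof -
  \<comment> \<open>After subtracting \<open>1 / y\<close> the weight is nonnegative for primes up
    to \<open>y\<close> and nonpositive beyond. So the prime factors may be replaced by all primes
    up to \<open>y\<close>, and the subtracted part sums to at most \<open>ln d / y\<close>.\<close>
  let ?g = "\<lambda>p. ln (real p) * (1 / (real p - 1) - 1 / real y)"
  have g1: "?g p \<ge> 0" if "prime p" "p \<le> y" for p
  proof -
    have "p > 1" using that prime_gt_1_nat by blast
    then have "1 / real y \<le> 1 / (real p - 1)" using that by (intro divide_left_mono) auto
    then show ?thesis using \<open>p > 1\<close> by simp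
  qed
  have g2: "?g p \<le> 0" if "prime p" "\<not> p \<le> y" for p
  proof -
    have p: "p > 1" using that prime_gt_1_nat by blast
    have "real y \<le> real p - 1" using that by linarith
    then have "1 / (real p - 1) \<le> 1 / real y" using assms p by (intro divide_left_mono) auto
    then show ?thesis using p by (simp add: mult_nonneg_nonpos)
  qed
  have "log_prime_sum d = (\<Sum>p\<in>prime_factors d. ?g p) + (\<Sum>p\<in>prime_factors d. ln (real p)) / real y"
    by (simp add: log_prime_sum_def sum_divide_distrib flip: sum.distrib) (simp add: algebra_simps)
  also have "(\<Sum>p\<in>prime_factors d. ln (real p)) / real y \<le> ln (real d) / real y"
    using sum_ln_prime_factors_le[OF assms(1)] by (rule divide_right_mono) simp
  also have "(\<Sum>p\<in>prime_factors d. ?g p) \<le> (\<Sum>p\<in>prime_factors d \<inter> {p. p \<le> y}. ?g p)"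
  proof -
    have "(\<Sum>p\<in>prime_factors d. ?g p) = (\<Sum>p\<in>prime_factors d \<inter> {p. p \<le> y}. ?g p) + (\<Sum>p\<in>prime_factors d - {p. p \<le> y}. ?g p)"
      by (simp add: sum.Int_Diff)
    also have "(\<Sum>p\<in>prime_factors d - {p. p \<le> y}. ?g p) \<le> 0"
      using g2 by (intro sum_nonpos) auto
    finally show ?thesis by simp
  qed
  also have "(\<Sum>p\<in>prime_factors d \<inter> {p. p \<le> y}. ?g p) \<le> (\<Sum>p | prime p \<and> p \<le> y. ?g p)"
    using g1 by (intro sum_mono2) auto
  finally show ?thesis by simp
qed

lemma primes_le_8: "{p::nat. prime p \<and> p \<le> 8} = {2, 3, 5, 7}"
proof -
  have "p \<in> {2, 3, 5, 7}" if "prime p" "p \<le> 8" for p :: nat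
  proof -
    have "p \<in> {0, 1, 2, 3, 4, 5, 6, 7, 8}" using that(2) by auto
    moreover have "\<not> prime (4::nat)" "\<not> prime (6::nat)" "\<not> prime (8::nat)" "\<not> prime (0::nat)" "\<not> prime (1::nat)"
      by simp_all
    ultimately show ?thesis using that(1) by auto
  qed
  moreover have "prime (2::nat)" "prime (3::nat)" "prime (5::nat)" "prime (7::nat)" by simp_all
  ultimately show ?thesis by auto
qed

lemma ln_small_primes:
  "ln (3::real) \<le> 10 / 9" "ln (5::real) \<le> 166 / 100" "ln (7::real) \<le> 205 / 100"
proof -
  show "ln (3::real) \<le> 10 / 9"
    by (rule ln_le_of_le_power[where n = 64]) (simp_all add: power_divide)
  show "ln (5::real) \<le> 166 / 100"
    by (rule ln_le_of_le_power[where n = 32]) (simp_all add: power_divide)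
  show "ln (7::real) \<le> 205 / 100"
    by (rule ln_le_of_le_power[where n = 32]) (simp_all add: power_divide)
qed

text \<open>Truncation at \<open>y = 8\<close>: the slope 1/8 in \<open>ln d\<close> buys a small
  constant, which makes the bound the right one for \<open>ln d\<close> up to 45.\<close>

lemma log_prime_sum_le_linear:
  assumes "d > 0"
  shows "log_prime_sum d \<le> 66 / 50 + ln (real d) / 8"
proof -
  have "log_prime_sum d \<le> (\<Sum>p\<in>{2, 3, 5, 7::nat}. ln (real p) * (1 / (real p - 1) - 1 / 8)) + ln (real d) / 8"
    using log_prime_sum_le_truncated[OF assms, of 8] primes_le_8 by simp
  also have "(\<Sum>p\<in>{2, 3, 5, 7::nat}. ln (real p) * (1 / (real p - 1) - 1 / 8))
      = ln 2 * (7 / 8) + ln 3 * (3 / 8) + ln 5 * (1 / 8) + ln 7 * (1 / 24)"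
    by simp
  also have "\<dots> \<le> 66 / 50" using ln2_le_25_over_36 ln_small_primes by simp
  finally show ?thesis by simp
qed

text \<open>Mertens' argument: \<open>ln (n!)\<close> is at most \<open>n * ln n\<close> and at
  least the sum of \<open>(n / p - 1) * ln p\<close> over primes up to \<open>n\<close>; the error,
  the sum of \<open>ln p\<close>, is at most \<open>n * ln 4\<close>.\<close>

lemma sum_ln_over_prime_le:
  assumes "n \<ge> 1"
  shows "(\<Sum>p | prime p \<and> p \<le> n. ln (real p) / real p) \<le> ln (real n) + ln 4"
proof -
  let ?P = "{p. prime p \<and> p \<le> n}"
  have pf: "prime_factors (fact n :: nat) = ?P"
    using prime_ge_2_nat by (auto simp: prime_factors_dvd prime_dvd_fact_iff)
  have "ln (real (fact n :: nat)) = (\<Sum>p\<in>?P. ln (real p ^ multiplicity p (fact n :: nat)))"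
  proof -
    have "(fact n :: nat) = (\<Prod>p\<in>?P. p ^ multiplicity p (fact n :: nat))"
      using prime_factorization_nat[of "fact n"] unfolding pf by simp
    then have "ln (real (fact n :: nat)) = ln (\<Prod>p\<in>?P. real p ^ multiplicity p (fact n :: nat))"
      by (metis (no_types, lifting) of_nat_power of_nat_prod prod.cong)
    then show ?thesis by (subst (asm) ln_prod) (auto dest: prime_gt_0_nat)
  qed
  moreover have "(\<Sum>p\<in>?P. ln (real p ^ multiplicity p (fact n :: nat))) \<ge> (\<Sum>p\<in>?P. real n * (ln (real p) / real p) - ln (real p))"
  proof (rule sum_mono)
    fix p assume "p \<in> ?P"
    then have p: "prime p" by simp
    have lnp: "ln (real p) \<ge> 0" using prime_ge_1_nat[OF p] by simp
    have "real n / real p - 1 \<le> real (n div p)"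
      using floor_divide_of_nat_eq[of n p, where ?'a = real] by linarith
    also have "\<dots> \<le> real (multiplicity p (fact n :: nat))"
      using multiplicity_fact_div[OF p, of n] by simp
    finally have "(real n / real p - 1) * ln (real p) \<le> real (multiplicity p (fact n :: nat)) * ln (real p)"
      using lnp by (rule mult_right_mono)
    then show "real n * (ln (real p) / real p) - ln (real p) \<le> ln (real p ^ multiplicity p (fact n :: nat))"
      by (simp add: ln_realpow algebra_simps)
  qed
  moreover have "ln (real (fact n :: nat)) \<le> real n * ln (real n)"
  proof -
    have "ln (real (fact n :: nat)) \<le> ln (real n ^ n)"
      using fact_le_power[of n, where ?'a = real] by (intro ln_mono) auto
    then show ?thesis by (simp add: ln_realpow)
  qed
  moreover have "(\<Sum>p\<in>?P. ln (real p)) \<le> real n * ln 4" by (rule sum_ln_primes_le)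
  ultimately have "real n * (\<Sum>p\<in>?P. ln (real p) / real p) \<le> real n * (ln (real n) + ln 4)"
    by (simp add: sum_subtractf sum_distrib_left distrib_left)
  then show ?thesis using assms by simp
qed

text \<open>The sum telescopes against \<open>(ln m + 3 / 2) / m\<close>. The number 3/2 bounds
  \<open>m * (ln m - ln (m - 1))\<close>, itself at most \<open>m / (m - 1)\<close>, for
  \<open>m \<ge> 3\<close>.\<close>

lemma sum_ln_over_consecutive_le:
  assumes "n \<ge> 2"
  shows "(\<Sum>m\<in>{2<..n}. ln (real m) / (real m * (real m - 1))) \<le> (ln 2 + 3 / 2) / 2 - (ln (real n) + 3 / 2) / real n"
  using assms
proof (induction n rule: dec_induct)
  case base
  then show ?case by simp
next
  case (step n)
  define m where "m = real (Suc n)"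
  have m: "m \<ge> 3" "real n = m - 1" using step by (simp_all add: m_def)
  have "ln (m / (m - 1)) \<le> m / (m - 1) - 1" using m by (intro ln_le_minus_one) auto
  also have "m / (m - 1) - 1 = 1 / (m - 1)" using m by (simp add: field_simps)
  finally have "ln m - ln (m - 1) \<le> 1 / (m - 1)" using m by (simp add: ln_div)
  then have "m * (ln m - ln (m - 1)) \<le> m * (1 / (m - 1))" using m by (intro mult_left_mono) auto
  also have "\<dots> \<le> 3 / 2" using m by (simp add: field_simps)
  finally have "m * (ln m - ln (m - 1)) \<le> 3 / 2" .
  moreover have "m * (ln (m - 1) + 3 / 2) - (m - 1) * (ln m + 3 / 2) = ln m + 3 / 2 - m * (ln m - ln (m - 1))"
    by (simp add: field_simps)
  ultimately have "ln m \<le> m * (ln (m - 1) + 3 / 2) - (m - 1) * (ln m + 3 / 2)" by linarith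
  then have "ln m / (m * (m - 1)) \<le> (m * (ln (m - 1) + 3 / 2) - (m - 1) * (ln m + 3 / 2)) / (m * (m - 1))"
    using m by (intro divide_right_mono) auto
  also have "\<dots> = (ln (m - 1) + 3 / 2) / (m - 1) - (ln m + 3 / 2) / m"
    using m by (simp add: diff_divide_distrib)
  finally have "ln m / (m * (m - 1)) \<le> (ln (m - 1) + 3 / 2) / (m - 1) - (ln m + 3 / 2) / m" .
  moreover have "{2<..Suc n} = insert (Suc n) {2<..n}" using step by auto
  ultimately show ?case using step.IH m by (simp flip: m_def)
qed

text \<open>Truncate at the integer part of \<open>ln d\<close> and split \<open>1 / (p - 1)\<close>
  into \<open>1 / p\<close> and \<open>1 / (p * (p - 1))\<close>. The constants add up to 3 ln 2 +
  3/4 + 46/45, where 46/45 bounds the tail because \<open>n \<ge> 45\<close>.\<close>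

lemma log_prime_sum_le_ln_ln:
  assumes "ln (real d) \<ge> 45"
  shows "log_prime_sum d \<le> ln (ln (real d)) + 387 / 100"
proof -
  define n where "n = nat \<lfloor>ln (real d)\<rfloor>"
  have n: "real n \<le> ln (real d)" "ln (real d) < real n + 1" "n \<ge> 45"
    using assms by (auto simp: n_def le_nat_floor)
  have d0: "d > 0" using assms by (cases "d = 0") auto
  have "log_prime_sum d \<le> (\<Sum>p | prime p \<and> p \<le> n. ln (real p) * (1 / (real p - 1) - 1 / real n)) + ln (real d) / real n"
    using log_prime_sum_le_truncated[OF d0, of n] n by simp
  also have "ln (real d) / real n \<le> 46 / 45" using n by (simp add: field_simps)
  also have "(\<Sum>p | prime p \<and> p \<le> n. ln (real p) * (1 / (real p - 1) - 1 / real n))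
      \<le> (\<Sum>p | prime p \<and> p \<le> n. ln (real p) / real p + ln (real p) / (real p * (real p - 1)))"
  proof (rule sum_mono)
    fix p assume "p \<in> {p. prime p \<and> p \<le> n}"
    then have p: "p > 1" using prime_gt_1_nat by blast
    then have "ln (real p) * (1 / (real p - 1) - 1 / real n) \<le> ln (real p) * (1 / (real p - 1))"
      by (intro mult_left_mono) auto
    moreover have "1 / (real p - 1) = 1 / real p + 1 / (real p * (real p - 1))"
      using p by (simp add: field_simps)
    then have "ln (real p) * (1 / (real p - 1)) = ln (real p) / real p + ln (real p) / (real p * (real p - 1))"
      by (simp only: distrib_left) simp
    ultimately show "ln (real p) * (1 / (real p - 1) - 1 / real n) \<le> ln (real p) / real p + ln (real p) / (real p * (real p - 1))"
      by linarith
  qed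
  also have "\<dots> = (\<Sum>p | prime p \<and> p \<le> n. ln (real p) / real p) + (\<Sum>p | prime p \<and> p \<le> n. ln (real p) / (real p * (real p - 1)))"
    by (rule sum.distrib)
  also have "(\<Sum>p | prime p \<and> p \<le> n. ln (real p) / real p) \<le> ln (real n) + ln 4"
    using n by (intro sum_ln_over_prime_le) auto
  also have "(\<Sum>p | prime p \<and> p \<le> n. ln (real p) / (real p * (real p - 1)))
      \<le> (\<Sum>p\<in>insert 2 {2<..n}. ln (real p) / (real p * (real p - 1)))"
  proof (rule sum_mono2)
    show "{p. prime p \<and> p \<le> n} \<subseteq> insert 2 {2<..n}"
    proof
      fix p assume "p \<in> {p. prime p \<and> p \<le> n}"
      then show "p \<in> insert 2 {2<..n}" using prime_ge_2_nat[of p] by (cases "p = 2") auto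
    qed
  qed (auto intro!: divide_nonneg_nonneg)
  also have "\<dots> = ln 2 / 2 + (\<Sum>p\<in>{2<..n}. ln (real p) / (real p * (real p - 1)))" by simp
  also have "(\<Sum>p\<in>{2<..n}. ln (real p) / (real p * (real p - 1))) \<le> (ln 2 + 3 / 2) / 2"
  proof -
    have "0 \<le> (ln (real n) + 3 / 2) / real n" using n by simp
    then show ?thesis using sum_ln_over_consecutive_le[of n] n by linarith
  qed
  also have "ln (real n) \<le> ln (ln (real d))" using n by (intro ln_mono) auto
  also have "ln (4::real) = 2 * ln 2" using ln_realpow[of 2 2] by simp
  finally have "log_prime_sum d \<le> ln (ln (real d)) + 2 * ln 2 + (ln 2 / 2 + (ln 2 + 3 / 2) / 2) + 46 / 45"
    by simp
  moreover have "(ln 2 + 3 / 2) / 2 = ln 2 / 2 + 3 / (4 :: real)" by (simp add: field_simps)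
  ultimately show ?thesis using ln2_le_25_over_36 by linarith
qed

text \<open>For \<open>L = ln d \<ge> 45\<close> the constants 3.87 and 1.39 exceed 4 by 1.26, and
  \<open>ln (ln L)\<close> is at least 1.28. Below 45, on each of four ranges, the increasing right
  side is estimated at the left endpoint and the linear bound at the right one. The leftmost
  endpoint 1.35 is a lower bound for \<open>ln 4\<close>, whence \<open>d \<ge> 4\<close>.\<close>

lemma log_prime_sum_bound:
  assumes "d \<ge> 4"
  shows "log_prime_sum d + ln 4 < ln (ln (real d)) + ln (ln (ln (real d))) + 4"
proof -
  define L where "L = ln (real d)"
  have ln4: "ln (4::real) \<ge> 135 / 100"
    by (rule ln_ge_of_ge_power[where n = 64]) (simp_all add: power_divide)
  have "ln (real d) \<ge> ln 4" using assms by (intro ln_mono) auto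
  then have L: "L \<ge> 135 / 100" using ln4 by (simp add: L_def)
  have ln4': "ln (4::real) \<le> 139 / 100"
    using ln_realpow[of 2 2] ln2_le_25_over_36 by simp
  have mono: "ln L + ln (ln L) \<ge> u + v" if "ln x \<ge> u" "ln u \<ge> v" "u > 0" "x > 0" "L \<ge> x" for x u v :: real
  proof -
    have "ln L \<ge> ln x" using that by (intro ln_mono) auto
    then have "ln L \<ge> u" using that by linarith
    moreover from this have "ln (ln L) \<ge> ln u" using that by (intro ln_mono) auto
    ultimately show ?thesis using that by linarith
  qed
  have lin: "log_prime_sum d \<le> 66 / 50 + L / 8"
    using log_prime_sum_le_linear assms by (simp add: L_def)
  have "log_prime_sum d + 139 / 100 < ln L + ln (ln L) + 4"
  proof -
    consider "L \<le> 2" | "2 \<le> L" "L \<le> 8" | "8 \<le> L" "L \<le> 31" | "31 \<le> L" "L \<le> 45" | "45 \<le> L"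
      by linarith
    then show ?thesis
    proof cases
      case 1
      have "ln L + ln (ln L) \<ge> 29 / 100 + (- (126 / 100))"
      proof (rule mono)
        show "29 / 100 \<le> ln (135 / 100 :: real)"
          by (rule ln_ge_of_ge_power[where n = 32]) (simp_all add: power_divide)
        show "- (126 / 100) \<le> ln (29 / 100 :: real)"
          by (rule ln_ge_of_ge_power[where n = 64]) (simp_all add: power_divide)
      qed (use L in auto)
      then show ?thesis using lin 1 by linarith
    next
      case 2
      have "ln L + ln (ln L) \<ge> 2 / 3 + (- (1 / 2))"
      proof (rule mono)
        show "2 / 3 \<le> ln (2 :: real)" by (rule ln2_ge_two_thirds)
        show "- (1 / 2) \<le> ln (2 / 3 :: real)"
          by (rule ln_ge_of_ge_power[where n = 4]) (simp_all add: power_divide)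
      qed (use 2 in auto)
      then show ?thesis using lin 2 by linarith
    next
      case 3
      have "ln L + ln (ln L) \<ge> 2 + 2 / 3"
      proof (rule mono)
        show "2 \<le> ln (8 :: real)"
          using ln_realpow[of 2 3] ln2_ge_two_thirds by simp
        show "2 / 3 \<le> ln (2 :: real)" by (rule ln2_ge_two_thirds)
      qed (use 3 in auto)
      then show ?thesis using lin 3 by linarith
    next
      case 4
      have "ln L + ln (ln L) \<ge> 33 / 10 + 11 / 10"
      proof (rule mono)
        show "33 / 10 \<le> ln (31 :: real)"
          by (rule ln_ge_of_ge_power[where n = 64]) (simp_all add: power_divide)
        show "11 / 10 \<le> ln (33 / 10 :: real)"
          by (rule ln_ge_of_ge_power[where n = 64]) (simp_all add: power_divide)
      qed (use 4 in auto)
      then show ?thesis using lin 4 by linarith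
    next
      case 5
      have "ln (37 / 10 :: real) \<ge> 128 / 100"
        by (rule ln_ge_of_ge_power[where n = 32]) (simp_all add: power_divide)
      moreover have "ln (37 / 10) \<le> ln (ln L)"
      proof (rule ln_mono)
        have "37 / 10 \<le> ln (45 :: real)"
          by (rule ln_ge_of_ge_power[where n = 80]) (simp_all add: power_divide)
        also have "\<dots> \<le> ln L" using 5 by (intro ln_mono) auto
        finally show "37 / 10 \<le> ln L" .
      qed simp_all
      moreover have "log_prime_sum d \<le> ln L + 387 / 100"
        using log_prime_sum_le_ln_ln[of d] 5 by (simp add: L_def)
      ultimately show ?thesis by linarith
    qed
  qed
  then show ?thesis using ln4' by (simp add: L_def)
qed

section \<open>The modulus 3\<close>

lemma log_prime_sum_3: "log_prime_sum 3 = ln 3 / 2"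
  by (simp add: log_prime_sum_def prime_factorization_prime)

text \<open>Here \<open>ln (ln 3)\<close> is about 0.094 and its logarithm about -2.36, so the right
  side is about 1.73. The left side is about 1.45; with \<open>ln 4\<close> in place of 9/10 it
  would be about 1.94.\<close>

lemma numeric_bound_3:
  "ln 3 / 2 + 9 / 10 < ln (ln (3 :: real)) + ln (ln (ln 3)) + 4"
proof -
  have 1: "1085 / 1000 \<le> ln (3 :: real)"
    by (rule ln_ge_of_ge_power[where n = 64]) (simp_all add: power_divide)
  have "8 / 100 \<le> ln (1085 / 1000 :: real)"
    by (rule ln_ge_of_ge_power[where n = 64]) (simp_all add: power_divide)
  also have "\<dots> \<le> ln (ln 3)" using 1 by (intro ln_mono) auto
  finally have 2: "8 / 100 \<le> ln (ln (3 :: real))" .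
  have "- (26 / 10) \<le> ln (8 / 100 :: real)"
    by (rule ln_ge_of_ge_power[where n = 64]) (simp_all add: power_divide)
  also have "\<dots> \<le> ln (ln (ln 3))" using 2 by (intro ln_mono) auto
  finally show ?thesis using 2 ln_small_primes(1) by simp
qed

text \<open>For \<open>d = 3\<close> the bound \<open>\<theta>(k) \<le> k ln 4\<close> is too weak, but iterating Chebyshev's device along
  the progression \<open>3 j + 2\<close> controls its own primes.\<close>
lemma eventually_sum_ln_primes_2_mod_3_le:
  "eventually (\<lambda>k. (\<Sum>p | prime p \<and> p mod 3 = 2 \<and> p \<le> k. ln (real p)) \<le> 9 / 10 * real k) sequentially"
proof -
  define g where "g k = (\<Sum>p | prime p \<and> p mod 3 = 2 \<and> p \<le> k. ln (real p))" for k :: nat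
  have nonneg: "ln (real p) \<ge> 0" if "prime p" for p using prime_ge_1_nat[OF that] by simp
  \<comment> \<open>With \<open>k = n div 3\<close>, a prime in \<open>(k, n]\<close> that is 2
    modulo 3 is itself a term \<open>3 * j + 2\<close> with \<open>1 \<le> j \<le> k\<close>, so the
    bound on large prime divisors counts it. The constant 5/3 bounds
    \<open>ln 3 + ln 3 / 2\<close>.\<close>
  have step: "g n \<le> g (n div 3) + 5 / 3 * real (n div 3) + ln (real (n div 3 + 1))" if "n \<ge> 6" for n
  proof -
    define k where "k = n div 3"
    have k: "k \<ge> 2" "n \<le> 3 * k + 2" using that by (simp_all add: k_def)
    let ?B = "{p. prime p \<and> k < p \<and> (\<exists>j\<in>{1..k}. p dvd 3 * j + 2)}"
    have finB: "finite ?B"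
    proof (rule finite_subset)
      show "?B \<subseteq> {..3 * k + 2}" by (auto dest!: dvd_imp_le)
    qed simp
    have "g n \<le> (\<Sum>p\<in>{p. prime p \<and> p mod 3 = 2 \<and> p \<le> k} \<union> ?B. ln (real p))"
      unfolding g_def
    proof (rule sum_mono2)
      show "{p. prime p \<and> p mod 3 = 2 \<and> p \<le> n} \<subseteq> {p. prime p \<and> p mod 3 = 2 \<and> p \<le> k} \<union> ?B"
      proof
        fix p assume p: "p \<in> {p. prime p \<and> p mod 3 = 2 \<and> p \<le> n}"
        show "p \<in> {p. prime p \<and> p mod 3 = 2 \<and> p \<le> k} \<union> ?B"
        proof (cases "p \<le> k")
          case False
          have "p = 3 * (p div 3) + 2" using p mult_div_mod_eq[of 3 p] by simp
          moreover have "p div 3 \<in> {1..k}" using calculation p k False by auto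
          ultimately show ?thesis using p False by (auto intro!: bexI[of _ "p div 3"])
        qed (use p in auto)
      qed
    qed (use finB nonneg in auto)
    also have "\<dots> \<le> g k + (\<Sum>p\<in>?B. ln (real p))"
      unfolding g_def using finB by (subst sum.union_disjoint) auto
    also have "(\<Sum>p\<in>?B. ln (real p)) \<le> real k * (ln (real 3) + log_prime_sum 3) + ln (real (k + 1))"
      by (rule sum_ln_large_prime_divisors_le) (simp_all add: coprime_commute)
    also have "real k * (ln (real 3) + log_prime_sum 3) \<le> real k * (5 / 3)"
      using ln_small_primes(1) by (intro mult_left_mono) (simp_all add: log_prime_sum_3)
    finally show ?thesis by (simp add: k_def)
  qed
  have "eventually (\<lambda>n::nat. ln (real n / 3 + 1) \<le> 2 / 100 * real n) sequentially" by real_asymp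
  then obtain N where N: "\<And>n. n \<ge> N \<Longrightarrow> ln (real n / 3 + 1) \<le> 2 / 100 * real n"
    by (auto simp: eventually_sequentially)
  define B where "B = real (N + 6) * ln 4"
  \<comment> \<open>Iterating \<open>step\<close> gives the slope (5/9) / (1 - 1/3) = 5/6; the
    allowance 2/100 for the logarithm raises it by 3/100, still below 87/100. The constant
    \<open>B\<close> covers the initial values.\<close>
  have bound: "g n \<le> 87 / 100 * real n + B" for n
  proof (induction n rule: less_induct)
    case (less n)
    show ?case
    proof (cases "n \<ge> N + 6")
      case True
      have "ln (real (n div 3 + 1)) \<le> ln (real n / 3 + 1)"
        using of_nat_div_le_of_nat[of n 3, where ?'a = real] by (intro ln_mono) auto
      also have "\<dots> \<le> 2 / 100 * real n" using N True by simp
      finally have "ln (real (n div 3 + 1)) \<le> 2 / 100 * real n" .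
      moreover have "g (n div 3) \<le> 87 / 100 * real (n div 3) + B" using less True by simp
      moreover have "real (n div 3) \<le> real n / 3" using of_nat_div_le_of_nat[of n 3, where ?'a = real] by simp
      ultimately show ?thesis using step[of n] True by linarith
    next
      case False
      have "g n \<le> (\<Sum>p | prime p \<and> p \<le> n. ln (real p))"
        unfolding g_def using nonneg by (intro sum_mono2) auto
      also have "\<dots> \<le> real n * ln 4" by (rule sum_ln_primes_le)
      also have "\<dots> \<le> B" unfolding B_def using False by (intro mult_right_mono) auto
      finally show ?thesis by simp
    qed
  qed
  have "eventually (\<lambda>n::nat. 87 / 100 * real n + B \<le> 9 / 10 * real n) sequentially" by real_asymp
  then show ?thesis
  proof (rule eventually_mono)
    fix k :: nat
    assume "87 / 100 * real k + B \<le> 9 / 10 * real k"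
    then show "(\<Sum>p | prime p \<and> p mod 3 = 2 \<and> p \<le> k. ln (real p)) \<le> 9 / 10 * real k"
      using bound[of k] unfolding g_def by linarith
  qed
qed

section \<open>Large gaps\<close>

lemma bqf_disc_mod_4: "bqf_disc a b c mod 4 = 0 \<or> bqf_disc a b c mod 4 = 1"
proof (cases "even b")
  case True
  then obtain t where "b = 2 * t" by (elim evenE)
  then have "bqf_disc a b c = 4 * (t * t - a * c)" by (simp add: bqf_disc_def power2_eq_square)
  then show ?thesis by simp
next
  case False
  then obtain t where "b = 2 * t + 1" by (elim oddE)
  then have "bqf_disc a b c = 4 * (t * t + t - a * c) + 1"
    by (simp add: bqf_disc_def power2_eq_square algebra_simps)
  then show ?thesis by presburger
qed

text \<open>This permits restriction to classes 0 and 1 modulo 4, where the Kronecker symbol has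
  been shown to be periodic modulo \<open>D\<close>.\<close>

lemma represented_set_filter_disc:
  "represented_set {D \<in> \<D>. D mod 4 = 0 \<or> D mod 4 = 1} = represented_set \<D>"
  unfolding represented_set_def using bqf_disc_mod_4 by auto

text \<open>For odd \<open>p\<close> other than 3, reciprocity gives (-3/p) = (p/3), which is 1 when
  \<open>p\<close> is 1 modulo 3.\<close>

lemma inert_minus_3:
  assumes "inert p (-3)"
  shows "p mod 3 = 2"
proof -
  have p: "prime p" "\<not> int p dvd -3" using assms inert_prime inert_not_dvd by blast+
  then have "p \<noteq> 3" by auto
  then have "\<not> 3 dvd p" using p(1) primes_dvd_imp_eq[of 3 p] by auto
  then have "p mod 3 = 1 \<or> p mod 3 = 2" by presburger
  moreover have "p mod 3 \<noteq> 1"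
  proof
    assume 1: "p mod 3 = 1"
    then have "p \<noteq> 2" by auto
    then have p2: "2 < p" using prime_ge_2_nat[OF p(1)] by linarith
    have odd: "odd_part (-3) = -3" "multiplicity 2 (-3 :: int) = 0"
      by (simp_all add: odd_part_def not_dvd_imp_multiplicity_0)
    have "[p = 1] (mod 3)" unfolding unique_euclidean_semiring_class.cong_def using 1 by simp
    then have "[int p = int 1] (mod int 3)" by (simp only: cong_int_iff)
    then have "[int p = 1] (mod 3)" by simp
    then have "Legendre (int p) 3 = Legendre 1 3" by (rule Legendre_cong)
    then have "kronecker (-3) (int p) = 1" by (simp add: kronecker_def odd)
    then have "Legendre (-3) (int p) = 1" using Legendre_eq_kronecker[OF p(1) p2 p(2)] by simp
    then have "QuadRes (int p) (-3)" by (auto simp: Legendre_def split: if_splits)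
    then show False using assms \<open>p \<noteq> 2\<close> by (simp add: inert_def)
  qed
  ultimately show ?thesis by blast
qed

text \<open>The only discriminants of absolute value at most 2 are 0 and 1, both squares. Hence the
  modulus is at least 3 and its iterated logarithms are genuine.\<close>

lemma nonsquare_disc_abs_ge_3:
  fixes D :: int
  assumes "D mod 4 = 0 \<or> D mod 4 = 1" "\<not> is_square D"
  shows "\<bar>D\<bar> \<ge> 3"
proof (rule ccontr)
  assume "\<not> ?thesis"
  then have "D \<in> {-2, -1, 0, 1, 2}" by auto
  moreover have "is_square (0 :: int)" "is_square (1 :: int)" by simp_all
  ultimately show False using assms by auto
qed

text \<open>From 3 on, which lies beyond \<open>exp 1\<close>, \<open>ln (ln x)\<close> is positive,
  so the outermost logarithm is taken where it is increasing.\<close>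

lemma triple_log_mono:
  fixes x y :: real
  assumes "3 \<le> x" "x \<le> y"
  shows "ln x + ln (ln x) + ln (ln (ln x)) \<le> ln y + ln (ln y) + ln (ln (ln y))"
proof -
  have "exp (1::real) < 3" using e_less_272 by simp
  then have "exp 1 < x" using assms by linarith
  then have "exp 1 < exp (ln x)" using assms by simp
  then have "1 < ln x" by (simp only: exp_less_cancel_iff)
  moreover from this have "ln x \<le> ln y" "0 < ln (ln x)" using assms by simp_all
  moreover from calculation have "ln (ln x) \<le> ln (ln y)" by simp
  moreover from calculation have "ln (ln (ln x)) \<le> ln (ln (ln y))" by simp
  ultimately show ?thesis by linarith
qed

text \<open>\<open>c\<close> is the price per unit of \<open>k\<close> of the primes of
  \<open>I\<close> up to \<open>k\<close>: 9/10 for the modulus 3, and \<open>ln 4\<close> for every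
  other modulus.\<close>

lemma gap_constant:
  fixes d :: nat and I :: "nat set"
  assumes "d \<ge> 3" and I: "\<And>p. p \<in> I \<Longrightarrow> prime p" and I3: "\<And>p. d = 3 \<Longrightarrow> p \<in> I \<Longrightarrow> p mod 3 = 2"
  shows "\<exists>c\<ge>0. eventually (\<lambda>k. (\<Sum>p | p \<in> I \<and> p \<le> k. ln (real p)) \<le> c * real k) sequentially \<and>
           log_prime_sum d + c < ln (ln (real d)) + ln (ln (ln (real d))) + 4"
proof -
  have nonneg: "ln (real p) \<ge> 0" if "prime p" for p using prime_ge_1_nat[OF that] by simp
  show ?thesis
  proof (cases "d = 3")
    case True
    have "(\<Sum>p | p \<in> I \<and> p \<le> k. ln (real p)) \<le> (\<Sum>p | prime p \<and> p mod 3 = 2 \<and> p \<le> k. ln (real p))" for k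
      using I I3[OF True] nonneg by (intro sum_mono2) auto
    then have "eventually (\<lambda>k. (\<Sum>p | p \<in> I \<and> p \<le> k. ln (real p)) \<le> 9 / 10 * real k) sequentially"
      using eventually_mono[OF eventually_sum_ln_primes_2_mod_3_le] order_trans by (smt (verit, best))
    then show ?thesis using numeric_bound_3 True by (intro exI[of _ "9 / 10"]) (simp add: log_prime_sum_3)
  next
    case False
    have "(\<Sum>p | p \<in> I \<and> p \<le> k. ln (real p)) \<le> ln 4 * real k" for k
    proof -
      have "(\<Sum>p | p \<in> I \<and> p \<le> k. ln (real p)) \<le> (\<Sum>p | prime p \<and> p \<le> k. ln (real p))"
        using I nonneg by (intro sum_mono2) auto
      also have "\<dots> \<le> ln 4 * real k" using sum_ln_primes_le[of k] by (simp add: mult.commute)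
      finally show ?thesis .
    qed
    then show ?thesis using log_prime_sum_bound[of d] False assms(1) by (intro exI[of _ "ln 4"]) simp
  qed
qed

theorem theorem1p1:
  fixes \<D> :: "int set" and s :: "nat \<Rightarrow> nat" and d :: int
  assumes "finite \<D>" and "\<D> \<noteq> {}"
    and "\<And>\<A>. \<A> \<subseteq> \<D> \<Longrightarrow> odd (card \<A>) \<Longrightarrow> \<not> is_square (\<Prod>D\<in>\<A>. D)"
    and "strict_mono s" and "range s = represented_set \<D>"
    and "d = Lcm ((\<lambda>D. \<bar>D\<bar>) ` \<D>)"
  shows "limsup (\<lambda>n. ereal ((real (s (Suc n)) - real (s n)) / ln (real (s n))))
           \<ge> ereal (1 / (ln (real_of_int d) + ln (ln (real_of_int d))
                        + ln (ln (ln (real_of_int d))) + 4))"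
proof -
  define E where "E = {D \<in> \<D>. D mod 4 = 0 \<or> D mod 4 = 1}"
  have finE: "finite E" and E\<D>: "E \<subseteq> \<D>" using assms(1) by (auto simp: E_def)
  have repE: "represented_set E = range s"
    using represented_set_filter_disc assms(5) by (simp add: E_def)
  have nonsq: "\<not> is_square D" if "D \<in> \<D>" for D
    using assms(3)[of "{D}"] that by simp
  have nz: "D \<noteq> 0" if "D \<in> \<D>" for D using nonsq[OF that] by auto
  define e where "e = nat (Lcm ((\<lambda>D. \<bar>D\<bar>) ` E))"
  have Lcm_pos: "Lcm ((\<lambda>D. \<bar>D\<bar>) ` F) > 0" if "F \<subseteq> \<D>" for F
  proof -
    have "finite F" using that assms(1) finite_subset by blast
    then have "Lcm ((\<lambda>D. \<bar>D\<bar>) ` F) \<noteq> 0" using that nz by (subst Lcm_0_iff) auto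
    moreover have "Lcm ((\<lambda>D. \<bar>D\<bar>) ` F) \<ge> 0" by simp
    ultimately show ?thesis by linarith
  qed
  have e: "int e = Lcm ((\<lambda>D. \<bar>D\<bar>) ` E)" "e > 0"
    using Lcm_pos[OF E\<D>] by (simp_all add: e_def)
  have De: "D dvd int e" if "D \<in> E" for D
    using dvd_Lcm[of "\<bar>D\<bar>" "(\<lambda>D. \<bar>D\<bar>) ` E"] that by (simp add: e)
  have "int e dvd d" unfolding e assms(6) using E\<D> by (intro Lcm_subset) auto
  then have ed: "int e \<le> d" using Lcm_pos[of \<D>] assms(6) by (intro zdvd_imp_le) auto
  have "s 0 \<in> represented_set E" using repE by simp
  then obtain D0 where D0: "D0 \<in> E" unfolding represented_set_def by blast
  have "3 \<le> \<bar>D0\<bar>" using D0 nonsq by (intro nonsquare_disc_abs_ge_3) (auto simp: E_def)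
  also have "\<bar>D0\<bar> \<le> int e" using De[OF D0] e by (intro zdvd_imp_le) auto
  finally have e3: "e \<ge> 3" by simp
  have "\<exists>a. coprime a e \<and> (\<forall>n D. n > 0 \<longrightarrow> [n = a] (mod e) \<longrightarrow> D \<in> E \<longrightarrow>
      (\<exists>p. inert p D \<and> odd (multiplicity p n)))"
  proof (rule exists_common_inert_class[OF finE])
    show "\<not> is_square (\<Prod>D\<in>\<A>. D)" if "\<A> \<subseteq> E" "odd (card \<A>)" for \<A>
      using assms(3) that E\<D> by (meson order_trans)
  qed (use e De in \<open>simp_all add: E_def\<close>)
  then obtain a0 where a0: "coprime a0 e"
    "\<And>n D. n > 0 \<Longrightarrow> [n = a0] (mod e) \<Longrightarrow> D \<in> E \<Longrightarrow> \<exists>p. inert p D \<and> odd (multiplicity p n)"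
    by blast
  \<comment> \<open>Reduction gives \<open>a \<le> e\<close>, which the comparison with the
    factorial requires; \<open>a\<close> is not 0 because it is prime to
    \<open>e \<ge> 3\<close>.\<close>
  define a where "a = a0 mod e"
  have a: "coprime a e" "0 < a" "a \<le> e"
  proof -
    show "coprime a e" using a0(1) e(2) by (simp add: a_def)
    then show "0 < a" using e3 by (cases "a = 0") auto
    show "a \<le> e" using e(2) by (simp add: a_def less_imp_le)
  qed
  \<comment> \<open>One set of primes serves all discriminants: the sieve preserves the exponent of
    each of them that divides a term, so which prime belongs to which \<open>D\<close> may vary with
    the term.\<close>
  define I where "I = {p. \<not> p dvd e \<and> (\<exists>D\<in>E. inert p D)}"
  have Ip: "prime p \<and> \<not> p dvd e" if "p \<in> I" for p using that inert_prime by (auto simp: I_def)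
  \<comment> \<open>If \<open>e = 3\<close>, every \<open>D\<close> is 3 or -3, and 3 is not a
    discriminant.\<close>
  have I3: "p mod 3 = 2" if "e = 3" "p \<in> I" for p
  proof -
    obtain D where D: "D \<in> E" "inert p D" using \<open>p \<in> I\<close> by (auto simp: I_def)
    have "\<bar>D\<bar> \<ge> 3" using D nonsq by (intro nonsquare_disc_abs_ge_3) (auto simp: E_def)
    moreover have "\<bar>D\<bar> \<le> 3" using De[OF D(1)] \<open>e = 3\<close> by (intro zdvd_imp_le) auto
    ultimately have "D = 3 \<or> D = -3" by linarith
    then have "D = -3" using D(1) by (auto simp: E_def)
    then show ?thesis using D(2) inert_minus_3 by blast
  qed
  obtain c where c: "c \<ge> 0" "eventually (\<lambda>k. (\<Sum>p | p \<in> I \<and> p \<le> k. ln (real p)) \<le> c * real k) sequentially"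
    "log_prime_sum e + c < ln (ln (real e)) + ln (ln (ln (real e))) + 4"
    using gap_constant[OF e3, of I] Ip I3 by blast
  define C where "C = ln (real e) + ln (ln (real e)) + ln (ln (ln (real e))) + 4"
  have "log_prime_sum e \<ge> 0"
    unfolding log_prime_sum_def by (intro sum_nonneg) (auto intro!: divide_nonneg_nonneg dest!: in_prime_factors_imp_prime prime_ge_1_nat)
  moreover have "ln (real e) > 0" using e3 by simp
  ultimately have C0: "C > 0" using c by (simp add: C_def)
  have s0: "0 < s 0" using assms(5) by (auto simp: represented_set_def)
  have "eventually (\<lambda>k. \<exists>y. s 0 \<le> y \<and> ln (real y) \<le> C * k \<and>
      (\<forall>j\<in>{1..k}. \<forall>p\<in>I. p dvd e * j + a \<longrightarrow> multiplicity p (y + j) = multiplicity p (e * j + a))) sequentially"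
    using c by (intro eventually_shifted_progression[OF a s0 Ip c(2)]) (simp_all add: C_def)
  then have "eventually (\<lambda>k. \<exists>y\<ge>s 0. ln (real y) \<le> C * k \<and> (\<forall>j\<in>{1..k}. y + j \<notin> range s)) sequentially"
  proof (rule eventually_mono)
    fix k
    assume "\<exists>y. s 0 \<le> y \<and> ln (real y) \<le> C * k \<and>
      (\<forall>j\<in>{1..k}. \<forall>p\<in>I. p dvd e * j + a \<longrightarrow> multiplicity p (y + j) = multiplicity p (e * j + a))"
    then obtain y where y: "s 0 \<le> y" "ln (real y) \<le> C * k"
      "\<And>j p. j \<in> {1..k} \<Longrightarrow> p \<in> I \<Longrightarrow> p dvd e * j + a \<Longrightarrow> multiplicity p (y + j) = multiplicity p (e * j + a)"
      by blast
    have "y + j \<notin> range s" if j: "j \<in> {1..k}" for j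
      unfolding repE[symmetric]
    proof (rule not_represented)
      fix D assume D: "D \<in> E"
      have "[e * j + a = a0] (mod e)" by (simp add: a_def unique_euclidean_semiring_class.cong_def mod_simps)
      then obtain p where p: "inert p D" "odd (multiplicity p (e * j + a))"
        using a0(2)[of "e * j + a" D] a(2) D by auto
      have pdvd: "p dvd e * j + a"
      proof (rule ccontr)
        assume "\<not> ?thesis"
        then have "multiplicity p (e * j + a) = 0" by (rule not_dvd_imp_multiplicity_0)
        then show False using p(2) by simp
      qed
      \<comment> \<open>A common prime of \<open>e\<close> and the term would divide
        \<open>a\<close>, which is prime to \<open>e\<close>; so the inert prime found for this term
        does lie in \<open>I\<close>.\<close>
      have "\<not> p dvd e"
      proof
        assume "p dvd e"
        then have "p dvd a" using pdvd by (metis dvd_add_right_iff dvd_mult2)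
        then have "p dvd 1" using \<open>p dvd e\<close> a(1) coprime_common_divisor by blast
        then show False using inert_prime[OF p(1)] not_prime_unit by blast
      qed
      then have "p \<in> I" using p(1) D by (auto simp: I_def)
      then have "multiplicity p (y + j) = multiplicity p (e * j + a)" using y(3) j pdvd by blast
      then show "\<exists>p. inert p D \<and> odd (multiplicity p (y + j))" using p by auto
    qed
    then show "\<exists>y\<ge>s 0. ln (real y) \<le> C * k \<and> (\<forall>j\<in>{1..k}. y + j \<notin> range s)" using y by blast
  qed
  then have lim: "limsup (\<lambda>n. ereal ((real (s (Suc n)) - real (s n)) / ln (real (s n)))) \<ge> ereal (1 / C)"
    by (rule limsup_gap_ge[OF assms(4) C0])
  have "C \<le> ln (real_of_int d) + ln (ln (real_of_int d)) + ln (ln (ln (real_of_int d))) + 4"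
  proof -
    have "real e \<le> real_of_int d" using ed by (metis of_int_le_iff of_int_of_nat_eq)
    then show ?thesis using triple_log_mono[of "real e" "real_of_int d"] e3 by (simp add: C_def)
  qed
  then have "1 / (ln (real_of_int d) + ln (ln (real_of_int d)) + ln (ln (ln (real_of_int d))) + 4) \<le> 1 / C"
    using C0 by (intro divide_left_mono) auto
  then show ?thesis using lim by (meson ereal_less_eq(3) order_trans)
qed

end
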